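(* Let $\bar{\mathbb{F}}\in\{\mathbb{A},\ldots,\mathbb{Z}\}$ be one of the $26$ families listed in the context, with fixed admissible parameters, and let $B_{\bar{\mathbb{F}}}$ be the corresponding algebra. For all integers $a,b,c,d\ge 0$ there exist unique coefficients $\Theta_{\bar{\mathbb{F}}}(a,b;c,d;\alpha,\beta;\gamma,\delta)\in\Bbbk$ ($\alpha,\beta,\gamma,\delta\ge0$ integers; only finitely many nonzero) such that \[ \mathrm{NF}_{\bar{\mathbb{F}}}(y_1^cy_2^dx_1^ax_2^b)=\sum_{\alpha,\beta,\gamma,\delta\ge0}\Theta_{\bar{\mathbb{F}}}(a,b;c,d;\alpha,\beta;\gamma,\delta)\,x_1^\alpha x_2^\beta y_1^\gamma y_2^\delta . \] The initial conditions are \[ \Theta_{\bar{\mathbb{F}}}(a,b;0,0;\alpha,\beta;0,0)=\delta_{\alpha,a}\delta_{\beta,b},\qquad \Theta_{\bar{\mathbb{F}}}(a,b;0,0;\alpha,\beta;\gamma,\delta)=0\ \text{ if }(\gamma,\delta)\neq(0,0). \] If $c+d>0$, define \[ (c',d',i_0)=\begin{cases}(c,d-1,2), & d>0,\\ (c-1,0,1), & d=0,\ c>0.\end{cases} \] Then \[ \Theta_{\bar{\mathbb{F}}}(a,b;c,d;\alpha,\beta;\gamma,\delta)=\sum_{\mu,\nu\ge0}\sum_{\ell=1}^{2}\sum_{u,v\ge0}W_{\bar{\mathbb{F}},i_0}^{(a,b)}(\mu,\nu;\ell)\,\Theta_{\bar{\mathbb{F}}}(\mu,\nu;c',d';\alpha,\beta;u,v)\,\Psi_{\bar{\mathbb{F}}}(u,v;\ell;\gamma,\delta).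 \]
   Context: **Ground field.** $\Bbbk$ is an algebraically closed field of characteristic zero; algebras are associative and unital. $\delta_{u,v}$ (with two subscripts) is the Kronecker delta; $\delta$ without subscripts is an integer index. **The families.** Each family $\bar{\mathbb{F}}$ is given by scalars $(q_{\bar{\mathbb{F}}},r_{\bar{\mathbb{F}}})$, $(p_{\bar{\mathbb{F}}},s_{\bar{\mathbb{F}}})$ and finite sets $\mathscr{K}_{i,s}^{\bar{\mathbb{F}}}\subseteq\Bbbk\times\{1,2\}\times\{1,2\}$, $i,s\in\{1,2\}$, of triples $(\lambda;t,\ell)$. The algebra $B_{\bar{\mathbb{F}}}$ is generated by $x_1,x_2,y_1,y_2$ with the six defining relations \[ x_2x_1=q_{\bar{\mathbb{F}}}x_1x_2+r_{\bar{\mathbb{F}}}x_1^2,\quad y_2y_1=p_{\bar{\mathbb{F}}}y_1y_2+s_{\bar{\mathbb{F}}}y_1^2,\quad y_ix_s=\sum_{(\lambda;t,\ell)\in\mathscr{K}_{i,s}^{\bar{\mathbb{F}}}}\lambda\,x_ty_\ell\ \ (i,s\in\{1,2\}). \] Values of $(q_{\bar{\mathbb{F}}},r_{\bar{\mathbb{F}}})$; $(p_{\bar{\mathbb{F}}},s_{\bar{\mathbb{F}}})$: $\mathbb{A}$: $(1,0);(1,1)$. $\mathbb{B},\mathbb{C}$: $(p,0);(p,0)$. $\mathbb{D},\mathbb{E},\mathbb{F}$: $(-1,0);(p,0)$. $\mathbb{G}$: $(1,0);(p,0)$. $\mathbb{H}$: $(1,1);(-1,0)$. $\mathbb{I},\mathbb{J},\mathbb{K},\mathbb{L}$: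 $(q,0);(-1,0)$. $\mathbb{M},\mathbb{N},\mathbb{O},\mathbb{P},\mathbb{Q},\mathbb{R},\mathbb{S},\mathbb{T},\mathbb{U}$: $(-1,0);(-1,0)$. $\mathbb{V},\mathbb{W},\mathbb{X},\mathbb{Y}$: $(1,0);(-1,0)$. $\mathbb{Z}$: $(-1,0);(1,0)$. Sets $\mathscr{K}_{1,1}\mid\mathscr{K}_{1,2}\mid\mathscr{K}_{2,1}\mid\mathscr{K}_{2,2}$ in this order: - $\mathbb{A}$: $(1;1,1)\mid(1;2,1),(1;1,2)\mid(1;1,2)\mid(-2;2,1),(-1;1,2),(1;2,2)$ - $\mathbb{B}$: $(1;2,2)\mid(1;1,2)\mid(-1;2,1)\mid(1;1,1)$ - $\mathbb{C}$: $(-1;1,1),(p^2;2,1),(1;1,2),(-p;2,2)\mid(-p;1,1),(1;2,1),(1;1,2),(-p;2,2)\mid(-p;1,1),(-2p^2;2,1),(p;1,2),(-p;2,2)\mid(-p;1,1),(p^2;2,1),(1;1,2),(-1;2,2)$ - $\mathbb{D}$: $(-p;1,1)\mid(-p^2;2,1),(1;1,2)\mid(p;1,2)\mid(1;1,1),(1;2,2)$ - $\mathbb{E}$: $(1;1,2),(1;2,2)\mid(1;1,2),(-1;2,2)\mid(-1;1,1),(1;2,1)\mid(1;1,1),(1;2,1)$ - $\mathbb{F}$: $(-1;1,1),(-p;2,1),(1;1,2),(-1;2,2)\mid(-p;1,1),(1;2,1),(1;1,2),(1;2,2)\mid(-p;1,1),(p;2,1),(p;1,2),(1;2,2)\mid(-p;1,1),(-p;2,1),(1;1,2),(-p;2,2)$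 - $\mathbb{G}$: $(p;1,1)\mid(p;1,1),(p^2;2,1),(1;1,2)\mid(p;1,2)\mid(f;1,1),(-1;1,2),(1;2,2)$ - $\mathbb{H}$: $(1;1,2)\mid(f;1,2),(1;2,2)\mid(1;1,1)\mid(f;1,1),(1;2,1)$ - $\mathbb{I}$: $(-q;1,1),(-q;2,1),(1;1,2),(-q;2,2)\mid(1;1,1),(1;2,1),(1;1,2),(-q;2,2)\mid(1;1,1),(q;2,1),(q;1,2),(-q;2,2)\mid(-1;1,1),(-q;2,1),(1;1,2),(-1;2,2)$ - $\mathbb{J}$: $(1;2,1),(1;2,2)\mid(-1;1,1),(1;1,2)\mid(1;2,1),(-1;2,2)\mid(1;1,1),(1;1,2)$ - $\mathbb{K}$: $(1;1,1)\mid(1;2,2)\mid(1;1,2)\mid(f;2,1)$ - $\mathbb{L}$: $(f;1,2)\mid(1;2,2)\mid(f;1,1)\mid(1;2,1)$ - $\mathbb{M}$: $(1;2,1),(1;1,2)\mid(f;1,1),(-1;2,2)\mid(1;1,1),(-1;2,2)\mid(-1;2,1),(-f;1,2)$ - $\mathbb{N}$: $(-g;2,1),(f;2,2)\mid(g;1,1),(f;1,2)\mid(f;2,1),(-g;2,2)\mid(f;1,1),(g;1,2)$ - $\mathbb{O}$: $(1;1,1),(f;2,2)\mid(-1;2,1),(1;1,2)\mid(f;2,1),(-1;1,2)\mid(1;1,1),(1;2,2)$ - $\mathbb{P}$: $(1;1,2),(f;2,2)\mid(1;1,2),(1;2,2)\mid(1;1,1),(-f;2,1)\mid(-1;1,1),(1;2,1)$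 - $\mathbb{Q}$: $(1;1,2)\mid(1;1,1),(1;2,1),(1;1,2)\mid(-1;1,1)\mid(1;1,1),(-1;1,2),(1;2,2)$ - $\mathbb{R}$: $(1;1,1),(1;2,1),(1;1,2)\mid(1;1,2)\mid(1;2,1)\mid(-1;2,1),(-1;1,2),(1;2,2)$ - $\mathbb{S}$: $(-1;1,1),(1;2,1),(1;1,2),(1;2,2)\mid(1;1,1),(-1;2,1),(1;1,2),(1;2,2)\mid(1;1,1),(1;2,1),(-1;1,2),(1;2,2)\mid(1;1,1),(1;2,1),(1;1,2),(-1;2,2)$ - $\mathbb{T}$: $(-1;1,1),(1;2,1),(1;1,2),(1;2,2)\mid(1;1,1),(-1;2,1),(1;1,2),(1;2,2)\mid(1;1,1),(1;2,1),(1;1,2),(-1;2,2)\mid(1;1,1),(1;2,1),(-1;1,2),(1;2,2)$ - $\mathbb{U}$: $(-1;1,1),(1;2,1),(1;1,2),(1;2,2)\mid(1;1,1),(1;2,1),(1;1,2),(-1;2,2)\mid(1;1,1),(1;2,1),(-1;1,2),(1;2,2)\mid(1;1,1),(-1;2,1),(1;1,2),(1;2,2)$ - $\mathbb{V}$: $(1;2,1),(1;1,2)\mid(1;2,1)\mid(-1;1,1),(1;2,1)\mid(1;2,2)$ - $\mathbb{W}$: $(f;2,1),(1;1,2)\mid(1;1,1),(-1;2,2)\mid(1;1,1),(f;2,2)\mid(-1;2,1),(1;1,2)$ - $\mathbb{X}$: $(1;1,2)\mid(1;1,2),(1;2,2)\mid(1;1,1)\mid(1;1,1),(1;2,1)$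 - $\mathbb{Y}$: $(1;1,1)\mid(f;1,1),(-1;2,1),(1;1,2)\mid(1;1,2)\mid(1;1,1),(f;1,2),(-1;2,2)$ - $\mathbb{Z}$: $(1;1,1),(1;2,2)\mid(1;2,1),(1;1,2)\mid(f;2,1),(-1;1,2)\mid(f;1,1),(-1;2,2)$ **Admissible parameters.** The parameters $p,q,f,g\in\Bbbk$ occurring in a family are assumed to be such that $q_{\bar{\mathbb{F}}},p_{\bar{\mathbb{F}}}\neq0$ and $B_{\bar{\mathbb{F}}}$ is a trimmed double extension of $R=\Bbbk\{x_1,x_2\}/\langle x_2x_1-q_{\bar{\mathbb{F}}}x_1x_2-r_{\bar{\mathbb{F}}}x_1^2\rangle$ (via $x_s\mapsto x_s$). Here a trimmed double extension of $R$ is an algebra $B$ containing $R$ as a subalgebra, generated by $R$ and elements $y_1,y_2$, such that: $y_2y_1=p_{12}y_1y_2+p_{11}y_1^2$ with $p_{12}\in\Bbbk^\times,p_{11}\in\Bbbk$; $y_ir=\sum_{j=1}^2\sigma_{ij}(r)y_j$ for all $r\in R$, for some maps $\sigma_{ij}:R\to R$; $B$ is a free left $R$-module with basis $\{y_1^iy_2^j\}_{i,j\ge0}$ and a free right $R$-module with basis $\{y_2^iy_1^j\}_{i,j\ge0}$; and $y_1R+y_2R+R=Ry_1+Ry_2+R$. **Normal form.** Consequently the monomials $x_1^ax_2^by_1^cy_2^d$ ($a,b,c,d\ge0$) form a $\Bbbk$-basis of $B_{\bar{\mathbb{F}}}$, and $\mathrm{NF}_{\bar{\mathbb{F}}}(\omega)$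 denotes the unique (finite) expansion of the element represented by $\omega$ in this basis. **Coefficients.** For $i\in\{1,2\}$, $a,b\ge0$, the scalars $W_{\bar{\mathbb{F}},i}^{(a,b)}(\alpha,\beta;\ell)$ are the coefficients in $\mathrm{NF}_{\bar{\mathbb{F}}}(y_ix_1^ax_2^b)=\sum_{\alpha,\beta\ge0}\sum_{\ell=1}^{2}W_{\bar{\mathbb{F}},i}^{(a,b)}(\alpha,\beta;\ell)x_1^\alpha x_2^\beta y_\ell$. For $q\in\Bbbk^\times$: $[n]_q:=1+q+\cdots+q^{n-1}$, $[0]_q:=0$; $\begin{bmatrix}0\\0\end{bmatrix}_q=1$, $\begin{bmatrix}n\\k\end{bmatrix}_q=0$ if $k<0$ or $k>n$, $\begin{bmatrix}n+1\\k\end{bmatrix}_q=\begin{bmatrix}n\\k-1\end{bmatrix}_q+q^k\begin{bmatrix}n\\k\end{bmatrix}_q$; $[m]_q^{\overline{k}}:=\prod_{j=0}^{k-1}[m+j]_q$; $\Lambda_{q,r}(n,m;k):=r^kq^{m(n-k)}\begin{bmatrix}n\\k\end{bmatrix}_q[m]_q^{\overline{k}}$, equal to $0$ if $k>n$ (with $0^0=1$). The array $\Psi_{\bar{\mathbb{F}}}$ is defined by $\mathrm{NF}_{\bar{\mathbb{F}}}(y_1^uy_2^vy_\ell)=\sum_{\gamma,\delta\ge0}\Psi_{\bar{\mathbb{F}}}(u,v;\ell;\gamma,\delta)y_1^\gamma y_2^\delta$; explicitly, \[ \Psi_{\bar{\mathbb{F}}}(u,v;2;\gamma,\delta)=\delta_{\gamma,u}\delta_{\delta,v+1},\qquad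 \Psi_{\bar{\mathbb{F}}}(u,v;1;\gamma,\delta)=\sum_{k=0}^{v}\Lambda_{p_{\bar{\mathbb{F}}},s_{\bar{\mathbb{F}}}}(v,1;k)\,\delta_{\gamma,u+1+k}\,\delta_{\delta,v-k}. \] *)

theory Defs
  imports
    "HOL-Library.Poly_Mapping"
    "HOL-Computational_Algebra.Polynomial"
    "HOL-Algebra.QuotRing"
    "HOL-Algebra.Generated_Rings"
    "HOL-Algebra.Module"
    "HOL-Algebra.Algebraic_Closure_Type"
begin

section \<open>Algebras over a field and presentations by generators and relations\<close>

text \<open>
  An algebra over the field given by the type \<open>'k\<close> is a (not necessarily commutative) ring record
  with a compatible module structure.  The library locale \<open>algebra\<close> requires commutativity.
\<close>

definition k_algebra :: "('k::field, 'a) module \<Rightarrow> bool" where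
  "k_algebra A \<longleftrightarrow> ring A \<and> module (ring_of_type_algebra :: 'k ring) A \<and>
     (\<forall>c. \<forall>x\<in>carrier A. \<forall>y\<in>carrier A.
        c \<odot>\<^bsub>A\<^esub> (x \<otimes>\<^bsub>A\<^esub> y) = (c \<odot>\<^bsub>A\<^esub> x) \<otimes>\<^bsub>A\<^esub> y \<and>
        c \<odot>\<^bsub>A\<^esub> (x \<otimes>\<^bsub>A\<^esub> y) = x \<otimes>\<^bsub>A\<^esub> (c \<odot>\<^bsub>A\<^esub> y))"

definition alg_hom :: "('k, 'a) module \<Rightarrow> ('k, 'b) module \<Rightarrow> ('a \<Rightarrow> 'b) set" where
  "alg_hom A B = {h \<in> ring_hom A B. \<forall>c. \<forall>x\<in>carrier A. h (c \<odot>\<^bsub>A\<^esub> x) = c \<odot>\<^bsub>B\<^esub> h x}"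

text \<open>
  Words under concatenation, written additively: multiplication of \<^type>\<open>poly_mapping\<close> is
  convolution over an additive monoid of keys, so \<open>'g fword \<Rightarrow>\<^sub>0 'k\<close> is the free associative
  algebra on \<open>'g\<close>.
\<close>

datatype 'g fword = FWord (letters: "'g list")

instantiation fword :: (type) monoid_add
begin

definition zero_fword :: "'a fword" where
  "zero_fword = FWord []"

definition plus_fword :: "'a fword \<Rightarrow> 'a fword \<Rightarrow> 'a fword" where
  "plus_fword u v = FWord (letters u @ letters v)"

instance
  by standard (simp_all add: zero_fword_def plus_fword_def)

end

definition gen :: "'g \<Rightarrow> ('g fword \<Rightarrow>\<^sub>0 'k::field)" where
  "gen g = Poly_Mapping.single (FWord [g]) 1"

definition scal :: "'k \<Rightarrow> ('g fword \<Rightarrow>\<^sub>0 'k::field)" where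
  "scal c = Poly_Mapping.single 0 c"

definition free_algebra :: "'g set \<Rightarrow> ('k::field, 'g fword \<Rightarrow>\<^sub>0 'k) module" where
  "free_algebra G =
     \<lparr>carrier = {h. \<forall>w\<in>Poly_Mapping.keys h. set (letters w) \<subseteq> G},
      monoid.mult = (*), one = 1, zero = 0, add = (+), module.smult = (\<lambda>c h. scal c * h)\<rparr>"

definition rel_ideal :: "'g set \<Rightarrow> ('g fword \<Rightarrow>\<^sub>0 'k::field) set \<Rightarrow> ('g fword \<Rightarrow>\<^sub>0 'k) set" where
  "rel_ideal G rels = Idl\<^bsub>free_algebra G\<^esub> rels"

definition presented ::
    "'g set \<Rightarrow> ('g fword \<Rightarrow>\<^sub>0 'k::field) set \<Rightarrow> ('k, ('g fword \<Rightarrow>\<^sub>0 'k) set) module" where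
  "presented G rels =
     (let A = free_algebra G; I = rel_ideal G rels; Q = A Quot I in
      \<lparr>carrier = carrier Q, monoid.mult = monoid.mult Q, one = one Q, zero = zero Q, add = add Q,
       module.smult = (\<lambda>c u. (I +>\<^bsub>A\<^esub> scal c) \<otimes>\<^bsub>Q\<^esub> u)\<rparr>)"

definition gen_class :: "'g set \<Rightarrow> ('g fword \<Rightarrow>\<^sub>0 'k::field) set \<Rightarrow> 'g \<Rightarrow> ('g fword \<Rightarrow>\<^sub>0 'k) set" where
  "gen_class G rels g = rel_ideal G rels +>\<^bsub>free_algebra G\<^esub> gen g"


section \<open>Trimmed double extensions\<close>

text \<open>
  \<open>R\<close> acts on \<open>B\<close> through \<open>\<iota>\<close>.  A family is a basis of a free module if every element has exactly one
  expansion with finitely supported coefficients in \<open>R\<close>.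
\<close>

definition free_left_basis ::
    "('k, 'r) module \<Rightarrow> ('k, 'b) module \<Rightarrow> ('r \<Rightarrow> 'b) \<Rightarrow> ('i \<Rightarrow> 'b) \<Rightarrow> bool" where
  "free_left_basis R B \<iota> e \<longleftrightarrow> (\<forall>n. e n \<in> carrier B) \<and>
     (\<forall>b\<in>carrier B. \<exists>!r. (\<forall>n. r n \<in> carrier R) \<and> finite {n. r n \<noteq> \<zero>\<^bsub>R\<^esub>} \<and>
        b = (\<Oplus>\<^bsub>B\<^esub>n\<in>{n. r n \<noteq> \<zero>\<^bsub>R\<^esub>}. \<iota> (r n) \<otimes>\<^bsub>B\<^esub> e n))"

definition free_right_basis ::
    "('k, 'r) module \<Rightarrow> ('k, 'b) module \<Rightarrow> ('r \<Rightarrow> 'b) \<Rightarrow> ('i \<Rightarrow> 'b) \<Rightarrow> bool" where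
  "free_right_basis R B \<iota> e \<longleftrightarrow> (\<forall>n. e n \<in> carrier B) \<and>
     (\<forall>b\<in>carrier B. \<exists>!r. (\<forall>n. r n \<in> carrier R) \<and> finite {n. r n \<noteq> \<zero>\<^bsub>R\<^esub>} \<and>
        b = (\<Oplus>\<^bsub>B\<^esub>n\<in>{n. r n \<noteq> \<zero>\<^bsub>R\<^esub>}. e n \<otimes>\<^bsub>B\<^esub> \<iota> (r n)))"

text \<open>
  The inclusion \<open>R \<subseteq> B\<close> is the injective algebra homomorphism \<open>\<iota>\<close>.  Since \<open>\<iota> ` carrier R\<close> contains
  the scalars, the subring generated by it and \<open>y\<^sub>1, y\<^sub>2\<close> is the generated subalgebra.
\<close>

definition trimmed_double_extension ::
    "('k::field, 'r) module \<Rightarrow> ('k, 'b) module \<Rightarrow> ('r \<Rightarrow> 'b) \<Rightarrow> 'b \<Rightarrow> 'b \<Rightarrow> bool" where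
  "trimmed_double_extension R B \<iota> y1 y2 \<longleftrightarrow>
     k_algebra R \<and> k_algebra B \<and> \<iota> \<in> alg_hom R B \<and> inj_on \<iota> (carrier R) \<and>
     y1 \<in> carrier B \<and> y2 \<in> carrier B \<and>
     generate_ring B (\<iota> ` carrier R \<union> {y1, y2}) = carrier B \<and>
     (\<exists>p12 p11. p12 \<noteq> 0 \<and>
        y2 \<otimes>\<^bsub>B\<^esub> y1 = p12 \<odot>\<^bsub>B\<^esub> (y1 \<otimes>\<^bsub>B\<^esub> y2) \<oplus>\<^bsub>B\<^esub> p11 \<odot>\<^bsub>B\<^esub> (y1 [^]\<^bsub>B\<^esub> (2::nat))) \<and>
     (\<exists>\<sigma>11 \<sigma>12 \<sigma>21 \<sigma>22.
        {\<sigma>11, \<sigma>12, \<sigma>21, \<sigma>22} \<subseteq> carrier R \<rightarrow> carrier R \<and>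
        (\<forall>r\<in>carrier R.
           y1 \<otimes>\<^bsub>B\<^esub> \<iota> r = \<iota> (\<sigma>11 r) \<otimes>\<^bsub>B\<^esub> y1 \<oplus>\<^bsub>B\<^esub> \<iota> (\<sigma>12 r) \<otimes>\<^bsub>B\<^esub> y2 \<and>
           y2 \<otimes>\<^bsub>B\<^esub> \<iota> r = \<iota> (\<sigma>21 r) \<otimes>\<^bsub>B\<^esub> y1 \<oplus>\<^bsub>B\<^esub> \<iota> (\<sigma>22 r) \<otimes>\<^bsub>B\<^esub> y2)) \<and>
     free_left_basis R B \<iota> (\<lambda>(i::nat, j::nat). y1 [^]\<^bsub>B\<^esub> i \<otimes>\<^bsub>B\<^esub> y2 [^]\<^bsub>B\<^esub> j) \<and>
     free_right_basis R B \<iota> (\<lambda>(i::nat, j::nat). y2 [^]\<^bsub>B\<^esub> i \<otimes>\<^bsub>B\<^esub> y1 [^]\<^bsub>B\<^esub> j) \<and>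
     {y1 \<otimes>\<^bsub>B\<^esub> \<iota> a \<oplus>\<^bsub>B\<^esub> y2 \<otimes>\<^bsub>B\<^esub> \<iota> b \<oplus>\<^bsub>B\<^esub> \<iota> c | a b c.
        a \<in> carrier R \<and> b \<in> carrier R \<and> c \<in> carrier R} =
     {\<iota> a \<otimes>\<^bsub>B\<^esub> y1 \<oplus>\<^bsub>B\<^esub> \<iota> b \<otimes>\<^bsub>B\<^esub> y2 \<oplus>\<^bsub>B\<^esub> \<iota> c | a b c.
        a \<in> carrier R \<and> b \<in> carrier R \<and> c \<in> carrier R}"


section \<open>The 26 families\<close>

text \<open>
  The arguments of a constructor are the parameters occurring in that family, always in the order
  \<open>p, q, f, g\<close>.
\<close>

datatype 'k family =
    Fam_A
  | Fam_B 'k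
  | Fam_C 'k
  | Fam_D 'k
  | Fam_E 'k
  | Fam_F 'k
  | Fam_G 'k 'k
  | Fam_H 'k
  | Fam_I 'k
  | Fam_J 'k
  | Fam_K 'k 'k
  | Fam_L 'k 'k
  | Fam_M 'k
  | Fam_N 'k 'k
  | Fam_O 'k
  | Fam_P 'k
  | Fam_Q
  | Fam_R
  | Fam_S
  | Fam_T
  | Fam_U
  | Fam_V
  | Fam_W 'k
  | Fam_X
  | Fam_Y 'k
  | Fam_Z 'k

text \<open>The pairs \<open>(q, r)\<close> and \<open>(p, s)\<close> of each family.\<close>

primrec parameters :: "'k::field family \<Rightarrow> ('k \<times> 'k) \<times> ('k \<times> 'k)" where
  "parameters Fam_A = ((1, 0), (1, 1))"
| "parameters (Fam_B p) = ((p, 0), (p, 0))"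
| "parameters (Fam_C p) = ((p, 0), (p, 0))"
| "parameters (Fam_D p) = ((- 1, 0), (p, 0))"
| "parameters (Fam_E p) = ((- 1, 0), (p, 0))"
| "parameters (Fam_F p) = ((- 1, 0), (p, 0))"
| "parameters (Fam_G p f) = ((1, 0), (p, 0))"
| "parameters (Fam_H f) = ((1, 1), (- 1, 0))"
| "parameters (Fam_I q) = ((q, 0), (- 1, 0))"
| "parameters (Fam_J q) = ((q, 0), (- 1, 0))"
| "parameters (Fam_K q f) = ((q, 0), (- 1, 0))"
| "parameters (Fam_L q f) = ((q, 0), (- 1, 0))"
| "parameters (Fam_M f) = ((- 1, 0), (- 1, 0))"
| "parameters (Fam_N f g) = ((- 1, 0), (- 1, 0))"
| "parameters (Fam_O f) = ((- 1, 0), (- 1, 0))"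
| "parameters (Fam_P f) = ((- 1, 0), (- 1, 0))"
| "parameters Fam_Q = ((- 1, 0), (- 1, 0))"
| "parameters Fam_R = ((- 1, 0), (- 1, 0))"
| "parameters Fam_S = ((- 1, 0), (- 1, 0))"
| "parameters Fam_T = ((- 1, 0), (- 1, 0))"
| "parameters Fam_U = ((- 1, 0), (- 1, 0))"
| "parameters Fam_V = ((1, 0), (- 1, 0))"
| "parameters (Fam_W f) = ((1, 0), (- 1, 0))"
| "parameters Fam_X = ((1, 0), (- 1, 0))"
| "parameters (Fam_Y f) = ((1, 0), (- 1, 0))"
| "parameters (Fam_Z f) = ((- 1, 0), (1, 0))"

definition q_of :: "'k::field family \<Rightarrow> 'k" where "q_of F = fst (fst (parameters F))"
definition r_of :: "'k::field family \<Rightarrow> 'k" where "r_of F = snd (fst (parameters F))"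
definition p_of :: "'k::field family \<Rightarrow> 'k" where "p_of F = fst (snd (parameters F))"
definition s_of :: "'k::field family \<Rightarrow> 'k" where "s_of F = snd (snd (parameters F))"

text \<open>
  The sets \<open>K\<^sub>1\<^sub>1, K\<^sub>1\<^sub>2, K\<^sub>2\<^sub>1, K\<^sub>2\<^sub>2\<close> in this order; the triple \<open>(c, t, l)\<close> stands for the summand
  \<open>c x\<^sub>t y\<^sub>l\<close> in the relation for \<open>y\<^sub>i x\<^sub>s\<close>.
\<close>

primrec K_table :: "'k::field family \<Rightarrow> ('k \<times> nat \<times> nat) set list" where
  "K_table Fam_A =
    [{(1, 1, 1)},
     {(1, 2, 1), (1, 1, 2)},
     {(1, 1, 2)},
     {(- 2, 2, 1), (- 1, 1, 2), (1, 2, 2)}]"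
| "K_table (Fam_B p) =
    [{(1, 2, 2)},
     {(1, 1, 2)},
     {(- 1, 2, 1)},
     {(1, 1, 1)}]"
| "K_table (Fam_C p) =
    [{(- 1, 1, 1), (p^2, 2, 1), (1, 1, 2), (- p, 2, 2)},
     {(- p, 1, 1), (1, 2, 1), (1, 1, 2), (- p, 2, 2)},
     {(- p, 1, 1), (- 2 * p^2, 2, 1), (p, 1, 2), (- p, 2, 2)},
     {(- p, 1, 1), (p^2, 2, 1), (1, 1, 2), (- 1, 2, 2)}]"
| "K_table (Fam_D p) =
    [{(- p, 1, 1)},
     {(- (p^2), 2, 1), (1, 1, 2)},
     {(p, 1, 2)},
     {(1, 1, 1), (1, 2, 2)}]"
| "K_table (Fam_E p) =
    [{(1, 1, 2), (1, 2, 2)},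
     {(1, 1, 2), (- 1, 2, 2)},
     {(- 1, 1, 1), (1, 2, 1)},
     {(1, 1, 1), (1, 2, 1)}]"
| "K_table (Fam_F p) =
    [{(- 1, 1, 1), (- p, 2, 1), (1, 1, 2), (- 1, 2, 2)},
     {(- p, 1, 1), (1, 2, 1), (1, 1, 2), (1, 2, 2)},
     {(- p, 1, 1), (p, 2, 1), (p, 1, 2), (1, 2, 2)},
     {(- p, 1, 1), (- p, 2, 1), (1, 1, 2), (- p, 2, 2)}]"
| "K_table (Fam_G p f) =
    [{(p, 1, 1)},
     {(p, 1, 1), (p^2, 2, 1), (1, 1, 2)},
     {(p, 1, 2)},
     {(f, 1, 1), (- 1, 1, 2), (1, 2, 2)}]"
| "K_table (Fam_H f) =
    [{(1, 1, 2)},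
     {(f, 1, 2), (1, 2, 2)},
     {(1, 1, 1)},
     {(f, 1, 1), (1, 2, 1)}]"
| "K_table (Fam_I q) =
    [{(- q, 1, 1), (- q, 2, 1), (1, 1, 2), (- q, 2, 2)},
     {(1, 1, 1), (1, 2, 1), (1, 1, 2), (- q, 2, 2)},
     {(1, 1, 1), (q, 2, 1), (q, 1, 2), (- q, 2, 2)},
     {(- 1, 1, 1), (- q, 2, 1), (1, 1, 2), (- 1, 2, 2)}]"
| "K_table (Fam_J q) =
    [{(1, 2, 1), (1, 2, 2)},
     {(- 1, 1, 1), (1, 1, 2)},
     {(1, 2, 1), (- 1, 2, 2)},
     {(1, 1, 1), (1, 1, 2)}]"
| "K_table (Fam_K q f) =
    [{(1, 1, 1)},
     {(1, 2, 2)},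
     {(1, 1, 2)},
     {(f, 2, 1)}]"
| "K_table (Fam_L q f) =
    [{(f, 1, 2)},
     {(1, 2, 2)},
     {(f, 1, 1)},
     {(1, 2, 1)}]"
| "K_table (Fam_M f) =
    [{(1, 2, 1), (1, 1, 2)},
     {(f, 1, 1), (- 1, 2, 2)},
     {(1, 1, 1), (- 1, 2, 2)},
     {(- 1, 2, 1), (- f, 1, 2)}]"
| "K_table (Fam_N f g) =
    [{(- g, 2, 1), (f, 2, 2)},
     {(g, 1, 1), (f, 1, 2)},
     {(f, 2, 1), (- g, 2, 2)},
     {(f, 1, 1), (g, 1, 2)}]"
| "K_table (Fam_O f) =
    [{(1, 1, 1), (f, 2, 2)},
     {(- 1, 2, 1), (1, 1, 2)},
     {(f, 2, 1), (- 1, 1, 2)},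
     {(1, 1, 1), (1, 2, 2)}]"
| "K_table (Fam_P f) =
    [{(1, 1, 2), (f, 2, 2)},
     {(1, 1, 2), (1, 2, 2)},
     {(1, 1, 1), (- f, 2, 1)},
     {(- 1, 1, 1), (1, 2, 1)}]"
| "K_table Fam_Q =
    [{(1, 1, 2)},
     {(1, 1, 1), (1, 2, 1), (1, 1, 2)},
     {(- 1, 1, 1)},
     {(1, 1, 1), (- 1, 1, 2), (1, 2, 2)}]"
| "K_table Fam_R =
    [{(1, 1, 1), (1, 2, 1), (1, 1, 2)},
     {(1, 1, 2)},
     {(1, 2, 1)},
     {(- 1, 2, 1), (- 1, 1, 2), (1, 2, 2)}]"
| "K_table Fam_S =
    [{(- 1, 1, 1), (1, 2, 1), (1, 1, 2), (1, 2, 2)},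
     {(1, 1, 1), (- 1, 2, 1), (1, 1, 2), (1, 2, 2)},
     {(1, 1, 1), (1, 2, 1), (- 1, 1, 2), (1, 2, 2)},
     {(1, 1, 1), (1, 2, 1), (1, 1, 2), (- 1, 2, 2)}]"
| "K_table Fam_T =
    [{(- 1, 1, 1), (1, 2, 1), (1, 1, 2), (1, 2, 2)},
     {(1, 1, 1), (- 1, 2, 1), (1, 1, 2), (1, 2, 2)},
     {(1, 1, 1), (1, 2, 1), (1, 1, 2), (- 1, 2, 2)},
     {(1, 1, 1), (1, 2, 1), (- 1, 1, 2), (1, 2, 2)}]"
| "K_table Fam_U =
    [{(- 1, 1, 1), (1, 2, 1), (1, 1, 2), (1, 2, 2)},
     {(1, 1, 1), (1, 2, 1), (1, 1, 2), (- 1, 2, 2)},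
     {(1, 1, 1), (1, 2, 1), (- 1, 1, 2), (1, 2, 2)},
     {(1, 1, 1), (- 1, 2, 1), (1, 1, 2), (1, 2, 2)}]"
| "K_table Fam_V =
    [{(1, 2, 1), (1, 1, 2)},
     {(1, 2, 1)},
     {(- 1, 1, 1), (1, 2, 1)},
     {(1, 2, 2)}]"
| "K_table (Fam_W f) =
    [{(f, 2, 1), (1, 1, 2)},
     {(1, 1, 1), (- 1, 2, 2)},
     {(1, 1, 1), (f, 2, 2)},
     {(- 1, 2, 1), (1, 1, 2)}]"
| "K_table Fam_X =
    [{(1, 1, 2)},
     {(1, 1, 2), (1, 2, 2)},
     {(1, 1, 1)},
     {(1, 1, 1), (1, 2, 1)}]"
| "K_table (Fam_Y f) =
    [{(1, 1, 1)},
     {(f, 1, 1), (- 1, 2, 1), (1, 1, 2)},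
     {(1, 1, 2)},
     {(1, 1, 1), (f, 1, 2), (- 1, 2, 2)}]"
| "K_table (Fam_Z f) =
    [{(1, 1, 1), (1, 2, 2)},
     {(1, 2, 1), (1, 1, 2)},
     {(f, 2, 1), (- 1, 1, 2)},
     {(f, 1, 1), (- 1, 2, 2)}]"

definition K_set :: "'k::field family \<Rightarrow> nat \<Rightarrow> nat \<Rightarrow> ('k \<times> nat \<times> nat) set" where
  "K_set F i s = K_table F ! (2 * (i - 1) + (s - 1))"

text \<open>Only the indices 1 and 2 are used as generators.\<close>

datatype letter = LX nat | LY nat

definition x_letters :: "letter set" where "x_letters = {LX 1, LX 2}"

definition xy_letters :: "letter set" where "xy_letters = {LX 1, LX 2, LY 1, LY 2}"

definition x_relation :: "'k::field family \<Rightarrow> (letter fword \<Rightarrow>\<^sub>0 'k)" where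
  "x_relation F = gen (LX 2) * gen (LX 1)
     - (scal (q_of F) * gen (LX 1) * gen (LX 2) + scal (r_of F) * gen (LX 1)^2)"

definition y_relation :: "'k::field family \<Rightarrow> (letter fword \<Rightarrow>\<^sub>0 'k)" where
  "y_relation F = gen (LY 2) * gen (LY 1)
     - (scal (p_of F) * gen (LY 1) * gen (LY 2) + scal (s_of F) * gen (LY 1)^2)"

definition yx_relation :: "'k::field family \<Rightarrow> nat \<Rightarrow> nat \<Rightarrow> (letter fword \<Rightarrow>\<^sub>0 'k)" where
  "yx_relation F i s = gen (LY i) * gen (LX s)
     - (\<Sum>(c, t, l)\<in>K_set F i s. scal c * gen (LX t) * gen (LY l))"

definition B_relations :: "'k::field family \<Rightarrow> (letter fword \<Rightarrow>\<^sub>0 'k) set" where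
  "B_relations F = {x_relation F, y_relation F} \<union> {yx_relation F i s | i s. i \<in> {1, 2} \<and> s \<in> {1, 2}}"

definition R_alg :: "'k::field family \<Rightarrow> ('k, (letter fword \<Rightarrow>\<^sub>0 'k) set) module" where
  "R_alg F = presented x_letters {x_relation F}"

definition B_alg :: "'k::field family \<Rightarrow> ('k, (letter fword \<Rightarrow>\<^sub>0 'k) set) module" where
  "B_alg F = presented xy_letters (B_relations F)"

definition xR :: "'k::field family \<Rightarrow> nat \<Rightarrow> (letter fword \<Rightarrow>\<^sub>0 'k) set" where
  "xR F s = gen_class x_letters {x_relation F} (LX s)"

definition xB :: "'k::field family \<Rightarrow> nat \<Rightarrow> (letter fword \<Rightarrow>\<^sub>0 'k) set" where
  "xB F s = gen_class xy_letters (B_relations F) (LX s)"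

definition yB :: "'k::field family \<Rightarrow> nat \<Rightarrow> (letter fword \<Rightarrow>\<^sub>0 'k) set" where
  "yB F i = gen_class xy_letters (B_relations F) (LY i)"

definition admissible :: "'k::field family \<Rightarrow> bool" where
  "admissible F \<longleftrightarrow> q_of F \<noteq> 0 \<and> p_of F \<noteq> 0 \<and>
     (\<exists>\<iota>. \<iota> (xR F 1) = xB F 1 \<and> \<iota> (xR F 2) = xB F 2 \<and>
          trimmed_double_extension (R_alg F) (B_alg F) \<iota> (yB F 1) (yB F 2))"


section \<open>Normal forms and structure coefficients\<close>

definition nf_monomial ::
    "'k::field family \<Rightarrow> nat \<Rightarrow> nat \<Rightarrow> nat \<Rightarrow> nat \<Rightarrow> (letter fword \<Rightarrow>\<^sub>0 'k) set" where
  "nf_monomial F a b c d =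
     xB F 1 [^]\<^bsub>B_alg F\<^esub> a \<otimes>\<^bsub>B_alg F\<^esub> xB F 2 [^]\<^bsub>B_alg F\<^esub> b \<otimes>\<^bsub>B_alg F\<^esub>
     yB F 1 [^]\<^bsub>B_alg F\<^esub> c \<otimes>\<^bsub>B_alg F\<^esub> yB F 2 [^]\<^bsub>B_alg F\<^esub> d"

text \<open>
  \<open>\<theta> \<alpha> \<beta> \<gamma> \<delta>\<close> is the coefficient of \<open>x\<^sub>1\<^sup>\<alpha> x\<^sub>2\<^sup>\<beta> y\<^sub>1\<^sup>\<gamma> y\<^sub>2\<^sup>\<delta>\<close> in a finite expansion of the element \<open>b\<close>.
\<close>

definition is_expansion ::
    "'k::field family \<Rightarrow> (letter fword \<Rightarrow>\<^sub>0 'k) set \<Rightarrow> (nat \<Rightarrow> nat \<Rightarrow> nat \<Rightarrow> nat \<Rightarrow> 'k) \<Rightarrow> bool" where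
  "is_expansion F b \<theta> \<longleftrightarrow>
     finite {(\<alpha>, \<beta>, \<gamma>, \<delta>). \<theta> \<alpha> \<beta> \<gamma> \<delta> \<noteq> 0} \<and>
     b = finsum (B_alg F)
           (\<lambda>(\<alpha>, \<beta>, \<gamma>, \<delta>). \<theta> \<alpha> \<beta> \<gamma> \<delta> \<odot>\<^bsub>B_alg F\<^esub> nf_monomial F \<alpha> \<beta> \<gamma> \<delta>)
           {(\<alpha>, \<beta>, \<gamma>, \<delta>). \<theta> \<alpha> \<beta> \<gamma> \<delta> \<noteq> 0}"

definition NF ::
    "'k::field family \<Rightarrow> (letter fword \<Rightarrow>\<^sub>0 'k) set \<Rightarrow> nat \<Rightarrow> nat \<Rightarrow> nat \<Rightarrow> nat \<Rightarrow> 'k" where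
  "NF F b = (THE \<theta>. is_expansion F b \<theta>)"

text \<open>The element \<open>y\<^sub>1\<^sup>c y\<^sub>2\<^sup>d x\<^sub>1\<^sup>a x\<^sub>2\<^sup>b\<close>.\<close>

definition yx_monomial ::
    "'k::field family \<Rightarrow> nat \<Rightarrow> nat \<Rightarrow> nat \<Rightarrow> nat \<Rightarrow> (letter fword \<Rightarrow>\<^sub>0 'k) set" where
  "yx_monomial F c d a b =
     yB F 1 [^]\<^bsub>B_alg F\<^esub> c \<otimes>\<^bsub>B_alg F\<^esub> yB F 2 [^]\<^bsub>B_alg F\<^esub> d \<otimes>\<^bsub>B_alg F\<^esub>
     xB F 1 [^]\<^bsub>B_alg F\<^esub> a \<otimes>\<^bsub>B_alg F\<^esub> xB F 2 [^]\<^bsub>B_alg F\<^esub> b"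

definition W :: "'k::field family \<Rightarrow> nat \<Rightarrow> nat \<Rightarrow> nat \<Rightarrow> nat \<Rightarrow> nat \<Rightarrow> nat \<Rightarrow> 'k" where
  "W F i a b \<alpha> \<beta> l =
     NF F (yB F i \<otimes>\<^bsub>B_alg F\<^esub> xB F 1 [^]\<^bsub>B_alg F\<^esub> a \<otimes>\<^bsub>B_alg F\<^esub> xB F 2 [^]\<^bsub>B_alg F\<^esub> b)
       \<alpha> \<beta> (if l = 1 then 1 else 0) (if l = 2 then 1 else 0)"

definition Psi :: "'k::field family \<Rightarrow> nat \<Rightarrow> nat \<Rightarrow> nat \<Rightarrow> nat \<Rightarrow> nat \<Rightarrow> 'k" where
  "Psi F u v l \<gamma> \<delta> =
     NF F (yB F 1 [^]\<^bsub>B_alg F\<^esub> u \<otimes>\<^bsub>B_alg F\<^esub> yB F 2 [^]\<^bsub>B_alg F\<^esub> v \<otimes>\<^bsub>B_alg F\<^esub> yB F l) 0 0 \<gamma> \<delta>"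

text \<open>The quantities in the closed formula for \<^const>\<open>Psi\<close>.\<close>

definition q_int :: "'k::field \<Rightarrow> nat \<Rightarrow> 'k" where
  "q_int q n = (\<Sum>i<n. q ^ i)"

fun q_binom :: "'k::field \<Rightarrow> nat \<Rightarrow> nat \<Rightarrow> 'k" where
  "q_binom q 0 0 = 1"
| "q_binom q 0 (Suc k) = 0"
| "q_binom q (Suc n) 0 = q_binom q n 0"
| "q_binom q (Suc n) (Suc k) = q_binom q n k + q ^ Suc k * q_binom q n (Suc k)"

definition q_rising :: "'k::field \<Rightarrow> nat \<Rightarrow> nat \<Rightarrow> 'k" where
  "q_rising q m k = (\<Prod>j<k. q_int q (m + j))"

definition Lambda :: "'k::field \<Rightarrow> 'k \<Rightarrow> nat \<Rightarrow> nat \<Rightarrow> nat \<Rightarrow> 'k" where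
  "Lambda q r n m k =
     (if k > n then 0 else r ^ k * q ^ (m * (n - k)) * q_binom q n k * q_rising q m k)"

definition Psi_formula :: "'k::field family \<Rightarrow> nat \<Rightarrow> nat \<Rightarrow> nat \<Rightarrow> nat \<Rightarrow> nat \<Rightarrow> 'k" where
  "Psi_formula F u v l \<gamma> \<delta> =
     (if l = 2 then of_bool (\<gamma> = u) * of_bool (\<delta> = v + 1)
      else (\<Sum>k\<le>v. Lambda (p_of F) (s_of F) v 1 k *
              of_bool (\<gamma> = u + 1 + k) * of_bool (\<delta> = v - k)))"

end

(*
  Since x2 x1 = q x1 x2 + r x1^2, the monomials x1^a x2^b span R; they are independent because the
  coefficient functionals of the would-be normal form carry a right action of the free algebra that
  is killed by the relation.  As B is free over R on the y1^c y2^d, the monomials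
  x1^a x2^b y1^c y2^d form a basis of B, so each coefficient of the normal form is a linear
  functional on B.  Peeling the last letter y_i off y1^c y2^d, rewriting y_i x1^a x2^b with W (its
  normal form is linear in the y's by the maps sigma_ij), expanding y1^c' y2^d' x1^mu x2^nu with
  Theta and finally moving y_l to its place with Psi gives the recursion.
*)
theory Submission
  imports Defs
begin

section \<open>Linear combinations, bases and linear functionals\<close>

text \<open>Independence of the monomials of \<open>R\<close> calls for linear functionals on a
  quotient of the free algebra, and these come from a representation. On the expected basis,
  \<open>x2\<close> must send \<open>x1^a x2^b\<close> to
  \<open>q^a x1^a x2^(b+1) + r [a]_q x1^(a+1) x2^b\<close>. The transpose of this map is used
  instead of the map itself: it acts on arbitrary functions of \<open>(a, b)\<close> by a pointwise
  formula, so that no finite support has to be carried along. Transposing reverses composition,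
  whence a right action. Acting on the indicator of one index pair and evaluating at
  \<open>(0, 0)\<close> gives the functional dual to that monomial. On \<open>B\<close>, linear
  functionals are applied to identities with finitely many terms. \<open>NF\<close> is a definite
  description and says nothing until expansions are known to exist and to be unique; from then on it
  is a coordinate vector, and the sums of the recursion run over finite supports.\<close>

locale k_alg =
  fixes A :: "('k::field, 'a) module" (structure)
  assumes k_algebra: "k_algebra A"

sublocale k_alg \<subseteq> ring A
  using k_algebra by (simp add: k_algebra_def)

context k_alg
begin

lemma scalars: "module (ring_of_type_algebra :: 'k ring) A"
  using k_algebra by (simp add: k_algebra_def)

lemma smult_closed [simp, intro]: "x \<in> carrier A \<Longrightarrow> c \<odot> x \<in> carrier A"
  using module.smult_closed[OF scalars] by (simp add: ring_of_type_algebra_def)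

lemma smult_add_left: "x \<in> carrier A \<Longrightarrow> (c + d) \<odot> x = c \<odot> x \<oplus> d \<odot> x"
  using module.smult_l_distr[OF scalars] by (simp add: ring_of_type_algebra_def)

lemma smult_add_right:
  "x \<in> carrier A \<Longrightarrow> y \<in> carrier A \<Longrightarrow> c \<odot> (x \<oplus> y) = c \<odot> x \<oplus> c \<odot> y"
  using module.smult_r_distr[OF scalars] by (simp add: ring_of_type_algebra_def)

lemma smult_smult: "x \<in> carrier A \<Longrightarrow> c \<odot> (d \<odot> x) = (c * d) \<odot> x"
  using module.smult_assoc1[OF scalars] by (simp add: ring_of_type_algebra_def)

lemma smult_one [simp]: "x \<in> carrier A \<Longrightarrow> 1 \<odot> x = x"
  using module.smult_one[OF scalars] by (simp add: ring_of_type_algebra_def)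

lemma smult_mult_left:
  "x \<in> carrier A \<Longrightarrow> y \<in> carrier A \<Longrightarrow> (c \<odot> x) \<otimes> y = c \<odot> (x \<otimes> y)"
  using k_algebra by (simp add: k_algebra_def)

lemma smult_mult_right:
  "x \<in> carrier A \<Longrightarrow> y \<in> carrier A \<Longrightarrow> x \<otimes> (c \<odot> y) = c \<odot> (x \<otimes> y)"
  using k_algebra unfolding k_algebra_def by metis

lemma smult_zero_left [simp]:
  assumes "x \<in> carrier A" shows "0 \<odot> x = \<zero>"
  using smult_add_left[OF assms, of 0 0] assms
  by (metis add.r_cancel_one' add_0 smult_closed)

lemma smult_zero_right [simp]: "c \<odot> \<zero> = \<zero>"
  using smult_add_right[of \<zero> \<zero> c] by (metis add.r_cancel_one' l_zero smult_closed zero_closed)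

end

section \<open>Finite linear combinations, coordinates and dual families\<close>

definition linear_functional :: "('k::field, 'a) module \<Rightarrow> ('a \<Rightarrow> 'k) \<Rightarrow> bool" where
  "linear_functional A f \<longleftrightarrow> (\<forall>x\<in>carrier A. \<forall>y\<in>carrier A. f (x \<oplus>\<^bsub>A\<^esub> y) = f x + f y) \<and>
     (\<forall>c. \<forall>x\<in>carrier A. f (c \<odot>\<^bsub>A\<^esub> x) = c * f x)"

text \<open>With a \<open>poly_mapping\<close> as coefficient family, finite support is part of the
  type, and a basis is a family for which \<open>lincomb\<close> is a bijection onto the
  carrier.\<close>

definition lincomb :: "('k::field, 'a) module \<Rightarrow> ('i \<Rightarrow> 'a) \<Rightarrow> ('i \<Rightarrow>\<^sub>0 'k) \<Rightarrow> 'a" where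
  "lincomb A e \<theta> = (\<Oplus>\<^bsub>A\<^esub>i\<in>Poly_Mapping.keys \<theta>. Poly_Mapping.lookup \<theta> i \<odot>\<^bsub>A\<^esub> e i)"

definition is_basis :: "('k::field, 'a) module \<Rightarrow> ('i \<Rightarrow> 'a) \<Rightarrow> bool" where
  "is_basis A e \<longleftrightarrow> (\<forall>i. e i \<in> carrier A) \<and> (\<forall>b\<in>carrier A. \<exists>!\<theta>. b = lincomb A e \<theta>)"

definition coord :: "('k::field, 'a) module \<Rightarrow> ('i \<Rightarrow> 'a) \<Rightarrow> 'a \<Rightarrow> ('i \<Rightarrow>\<^sub>0 'k)" where
  "coord A e b = (THE \<theta>. b = lincomb A e \<theta>)"

context k_alg
begin

lemma lincomb_closed [simp]: "(\<And>i. e i \<in> carrier A) \<Longrightarrow> lincomb A e \<theta> \<in> carrier A"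
  unfolding lincomb_def by (rule finsum_closed) auto

lemma lincomb_superset:
  assumes "\<And>i. e i \<in> carrier A" "finite S" "Poly_Mapping.keys \<theta> \<subseteq> S"
  shows "lincomb A e \<theta> = (\<Oplus>i\<in>S. Poly_Mapping.lookup \<theta> i \<odot> e i)"
  unfolding lincomb_def using assms
  by (intro add.finprod_mono_neutral_cong_left) (auto simp: in_keys_iff)

lemma lincomb_add:
  assumes "\<And>i. e i \<in> carrier A"
  shows "lincomb A e (\<theta> + \<theta>') = lincomb A e \<theta> \<oplus> lincomb A e \<theta>'"
proof -
  let ?S = "Poly_Mapping.keys \<theta> \<union> Poly_Mapping.keys \<theta>'"
  have "lincomb A e (\<theta> + \<theta>') =
      (\<Oplus>i\<in>?S. Poly_Mapping.lookup \<theta> i \<odot> e i \<oplus> Poly_Mapping.lookup \<theta>' i \<odot> e i)"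
    using assms Poly_Mapping.keys_add[of \<theta> \<theta>']
    by (simp add: lincomb_superset[of e ?S] lookup_add smult_add_left)
  also have "\<dots> = lincomb A e \<theta> \<oplus> lincomb A e \<theta>'"
    using assms by (simp add: lincomb_superset[of e ?S] finsum_addf)
  finally show ?thesis .
qed

lemma lincomb_smult:
  assumes "\<And>i. e i \<in> carrier A"
  shows "lincomb A e (Poly_Mapping.map ((*) c) \<theta>) = c \<odot> lincomb A e \<theta>"
proof -
  have lin: "c \<odot> (\<Oplus>i\<in>S. g i) = (\<Oplus>i\<in>S. c \<odot> g i)" if "finite S" "g \<in> S \<rightarrow> carrier A" for S :: "'b set" and g
    using that by (induction S) (auto simp: smult_add_right Pi_iff)
  have "lincomb A e (Poly_Mapping.map ((*) c) \<theta>) =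
      (\<Oplus>i\<in>Poly_Mapping.keys \<theta>. Poly_Mapping.lookup (Poly_Mapping.map ((*) c) \<theta>) i \<odot> e i)"
    using assms by (intro lincomb_superset) (auto simp: in_keys_iff Poly_Mapping.map.rep_eq)
  also have "\<dots> = (\<Oplus>i\<in>Poly_Mapping.keys \<theta>. c \<odot> (Poly_Mapping.lookup \<theta> i \<odot> e i))"
    using assms by (intro finsum_cong') (auto simp: Poly_Mapping.map.rep_eq smult_smult when_def)
  also have "\<dots> = c \<odot> lincomb A e \<theta>"
    unfolding lincomb_def using assms by (subst lin) auto
  finally show ?thesis .
qed

lemma lincomb_zero [simp]: "lincomb A e 0 = \<zero>"
  by (simp add: lincomb_def)

lemma lincomb_single:
  assumes "\<And>i. e i \<in> carrier A"
  shows "lincomb A e (Poly_Mapping.single i c) = c \<odot> e i"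
  using assms by (subst lincomb_superset[of _ "{i}"]) (auto simp: finsum_singleton)

lemma finsum_in_span:
  assumes "\<And>i. e i \<in> carrier A" "finite S" "\<And>s. s \<in> S \<Longrightarrow> g s \<in> range (lincomb A e)"
  shows "(\<Oplus>s\<in>S. g s) \<in> range (lincomb A e)"
  using assms(2,3)
proof (induction S)
  case empty
  then show ?case by (auto simp: image_iff intro: exI[of _ 0])
next
  case (insert s S)
  from insert obtain \<theta> \<theta>' where "g s = lincomb A e \<theta>" "(\<Oplus>s\<in>S. g s) = lincomb A e \<theta>'"
    by (metis (no_types, lifting) imageE insertCI)
  moreover have "g \<in> insert s S \<rightarrow> carrier A"
    using insert.prems assms(1) by fastforce
  ultimately show ?case
    using insert.hyps assms(1) by (auto simp: lincomb_add[symmetric] Pi_iff)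
qed

lemma linear_functional_add:
  "linear_functional A f \<Longrightarrow> x \<in> carrier A \<Longrightarrow> y \<in> carrier A \<Longrightarrow> f (x \<oplus> y) = f x + f y"
  by (simp add: linear_functional_def)

lemma linear_functional_finsum:
  assumes "linear_functional A f" "finite S" "g \<in> S \<rightarrow> carrier A"
  shows "f (\<Oplus>s\<in>S. g s) = (\<Sum>s\<in>S. f (g s))"
  using assms(2,3)
proof (induction S)
  case empty
  have "f (0 \<odot> \<zero>) = 0 * f \<zero>"
    using assms(1) unfolding linear_functional_def by blast
  then show ?case by simp
next
  case (insert s S)
  then show ?case using assms(1) by (simp add: linear_functional_def Pi_iff)
qed

lemma linear_functional_lincomb:
  assumes "linear_functional A f" "\<And>i. e i \<in> carrier A"
  shows "f (lincomb A e \<theta>) =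
    (\<Sum>i\<in>Poly_Mapping.keys \<theta>. Poly_Mapping.lookup \<theta> i * f (e i))"
proof -
  have "f (lincomb A e \<theta>) =
      (\<Sum>i\<in>Poly_Mapping.keys \<theta>. f (Poly_Mapping.lookup \<theta> i \<odot> e i))"
    unfolding lincomb_def using assms by (intro linear_functional_finsum) auto
  then show ?thesis using assms by (simp add: linear_functional_def)
qed

text \<open>Applying \<open>f i\<close> to a linear combination reads off its coefficient at
  \<open>i\<close>, so a dual family makes \<open>lincomb\<close> injective.\<close>

lemma is_basisI:
  assumes e: "\<And>i. e i \<in> carrier A"
    and span: "carrier A \<subseteq> range (lincomb A e)"
    and dual: "\<And>i. linear_functional A (f i)" "\<And>i j. f i (e j) = of_bool (i = j)"
  shows "is_basis A e"
proof -
  have eq: "Poly_Mapping.lookup \<theta> i = f i (lincomb A e \<theta>)" for \<theta> i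
    by (auto simp: linear_functional_lincomb dual e of_bool_def in_keys_iff sum.delta'
        if_distrib[of "(*) _"] cong: if_cong)
  have "inj (lincomb A e)"
    by (intro injI poly_mapping_eqI) (simp add: eq)
  then show ?thesis
    using e span unfolding is_basis_def by (blast dest: injD)
qed

lemma is_basis_closed: "is_basis A e \<Longrightarrow> e i \<in> carrier A"
  by (simp add: is_basis_def)

lemma lincomb_coord:
  assumes "is_basis A e" "b \<in> carrier A"
  shows "lincomb A e (coord A e b) = b"
proof -
  have "\<exists>!\<theta>. b = lincomb A e \<theta>" using assms by (simp add: is_basis_def)
  from theI'[OF this] show ?thesis by (simp add: coord_def)
qed

lemma coord_lincomb:
  assumes "is_basis A e"
  shows "coord A e (lincomb A e \<theta>) = \<theta>"
proof -
  have "lincomb A e \<theta> \<in> carrier A" using assms by (simp add: is_basis_closed)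
  then have "\<exists>!\<theta>'. lincomb A e \<theta> = lincomb A e \<theta>'" using assms unfolding is_basis_def by blast
  then show ?thesis unfolding coord_def by (intro the1_equality) auto
qed

lemma coord_basis:
  assumes "is_basis A e"
  shows "coord A e (e i) = Poly_Mapping.single i 1"
  using coord_lincomb[OF assms, of "Poly_Mapping.single i 1"] is_basis_closed[OF assms]
  by (simp add: lincomb_single)

lemma linear_functional_coord:
  assumes "is_basis A e"
  shows "linear_functional A (\<lambda>b. Poly_Mapping.lookup (coord A e b) i)"
  unfolding linear_functional_def
proof (intro conjI ballI allI)
  note e = is_basis_closed[OF assms]
  fix x y assume "x \<in> carrier A" "y \<in> carrier A"
  then obtain \<theta> \<theta>' where xy: "x = lincomb A e \<theta>" "y = lincomb A e \<theta>'"
    using lincomb_coord[OF assms] by metis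
  show "Poly_Mapping.lookup (coord A e (x \<oplus> y)) i =
      Poly_Mapping.lookup (coord A e x) i + Poly_Mapping.lookup (coord A e y) i"
    by (simp add: xy lincomb_add[symmetric] e coord_lincomb[OF assms] lookup_add)
next
  note e = is_basis_closed[OF assms]
  fix c x assume "x \<in> carrier A"
  then obtain \<theta> where x: "x = lincomb A e \<theta>"
    using lincomb_coord[OF assms] by metis
  show "Poly_Mapping.lookup (coord A e (c \<odot> x)) i = c * Poly_Mapping.lookup (coord A e x) i"
    by (simp add: x lincomb_smult[symmetric] e coord_lincomb[OF assms]
        Poly_Mapping.map.rep_eq when_def)
qed

lemma linear_functional_mult_left:
  assumes "linear_functional A f" "z \<in> carrier A"
  shows "linear_functional A (\<lambda>x. f (z \<otimes> x))"
  using assms by (simp add: linear_functional_def r_distr smult_mult_right)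

lemma linear_functional_mult_right:
  assumes "linear_functional A f" "z \<in> carrier A"
  shows "linear_functional A (\<lambda>x. f (x \<otimes> z))"
  using assms by (simp add: linear_functional_def l_distr smult_mult_left)

lemma finsum_Times:
  assumes "finite S" "finite T" "\<And>s t. g s t \<in> carrier A"
  shows "finsum A (\<lambda>(s, t). g s t) (S \<times> T) = (\<Oplus>t\<in>T. \<Oplus>s\<in>S. g s t)"
  using assms(2)
proof (induction T)
  case empty
  then show ?case by simp
next
  case (insert t T)
  have "finsum A (\<lambda>(s, t). g s t) (S \<times> insert t T) = finsum A (\<lambda>(s, t). g s t) (S \<times> T \<union> S \<times> {t})"
    by (rule arg_cong[of _ _ "finsum A _"]) auto
  also have "\<dots> = finsum A (\<lambda>(s, t). g s t) (S \<times> T) \<oplus> finsum A (\<lambda>(s, t). g s t) (S \<times> {t})"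
    using assms(1,3) insert by (intro finsum_Un_disjoint) auto
  also have "S \<times> {t} = (\<lambda>s. (s, t)) ` S" by auto
  also have "finsum A (\<lambda>(s, t). g s t) ((\<lambda>s. (s, t)) ` S) = (\<Oplus>s\<in>S. g s t)"
    using assms by (subst finsum_reindex) (auto simp: inj_on_def)
  finally show ?case
    using insert assms by (simp add: a_comm)
qed

text \<open>On its way through \<open>x^n\<close>, the factor \<open>y\<close> may pass
  \<open>j\<close> copies of \<open>x\<close>, each at the cost of \<open>q\<close>, and then be
  turned into \<open>x\<close> at the cost of \<open>r\<close>; summing \<open>r * q^j\<close> over
  \<open>j < n\<close> gives the second coefficient. Both planes use this: \<open>x1\<close>,
  \<open>x2\<close> for spanning \<open>R\<close>, and \<open>y1\<close>, \<open>y2\<close> for the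
  formula of \<open>Psi\<close>.\<close>

lemma commute_power:
  assumes [simp]: "x \<in> carrier A" "y \<in> carrier A"
    and yx: "y \<otimes> x = q \<odot> (x \<otimes> y) \<oplus> r \<odot> (x \<otimes> x)"
  shows "y \<otimes> x [^] n = q ^ n \<odot> (x [^] n \<otimes> y) \<oplus> (r * q_int q n) \<odot> x [^] Suc n"
proof (induction n)
  case 0
  then show ?case by (simp add: q_int_def)
next
  case (Suc n)
  have q: "q_int q (Suc n) = q ^ n + q_int q n" by (simp add: q_int_def)
  have "y \<otimes> x [^] Suc n = (y \<otimes> x [^] n) \<otimes> x" by (simp add: m_assoc)
  also have "\<dots> = q ^ n \<odot> (x [^] n \<otimes> (y \<otimes> x)) \<oplus> (r * q_int q n) \<odot> x [^] Suc (Suc n)"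
    unfolding Suc by (simp add: l_distr smult_mult_left m_assoc)
  also have "x [^] n \<otimes> (y \<otimes> x) = q \<odot> (x [^] Suc n \<otimes> y) \<oplus> r \<odot> x [^] Suc (Suc n)"
    unfolding yx by (simp add: r_distr smult_mult_right m_assoc)
  finally show ?case
    by (simp add: q smult_add_right smult_smult smult_add_left algebra_simps a_ac)
qed

end

section \<open>Presented algebras\<close>

lemma free_algebra_simps [simp]:
  "monoid.mult (free_algebra G) = (*)" "one (free_algebra G) = 1"
  "zero (free_algebra G) = 0" "add (free_algebra G) = (+)"
  by (simp_all add: free_algebra_def)

lemma carrier_free_algebra:
  "h \<in> carrier (free_algebra G) \<longleftrightarrow> (\<forall>w\<in>Poly_Mapping.keys h. set (letters w) \<subseteq> G)"
  by (simp add: free_algebra_def)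

lemma single_in_free_algebra:
  "set (letters w) \<subseteq> G \<Longrightarrow> Poly_Mapping.single w c \<in> carrier (free_algebra G)"
  by (simp add: carrier_free_algebra)

lemma scal_in_free_algebra [simp]: "scal c \<in> carrier (free_algebra G)"
  by (simp add: scal_def single_in_free_algebra zero_fword_def)

lemma gen_in_free_algebra [simp]: "g \<in> G \<Longrightarrow> gen g \<in> carrier (free_algebra G)"
  by (simp add: gen_def single_in_free_algebra)

lemma add_in_free_algebra [simp]:
  "h \<in> carrier (free_algebra G) \<Longrightarrow> h' \<in> carrier (free_algebra G) \<Longrightarrow>
    h + h' \<in> carrier (free_algebra G)"
  using Poly_Mapping.keys_add[of h h'] by (fastforce simp: carrier_free_algebra)

lemma uminus_in_free_algebra [simp]:
  "h \<in> carrier (free_algebra G) \<Longrightarrow> - h \<in> carrier (free_algebra G)"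
  by (simp add: carrier_free_algebra in_keys_iff)

lemma diff_in_free_algebra [simp]:
  "h \<in> carrier (free_algebra G) \<Longrightarrow> h' \<in> carrier (free_algebra G) \<Longrightarrow>
    h - h' \<in> carrier (free_algebra G)"
  using add_in_free_algebra[of h G "- h'"] by simp

lemma mult_in_free_algebra [simp]:
  assumes "h \<in> carrier (free_algebra G)" "h' \<in> carrier (free_algebra G)"
  shows "h * h' \<in> carrier (free_algebra G)"
  unfolding carrier_free_algebra
proof
  fix w assume "w \<in> Poly_Mapping.keys (h * h')"
  then obtain u v where "w = u + v" "u \<in> Poly_Mapping.keys h" "v \<in> Poly_Mapping.keys h'"
    using Poly_Mapping.keys_mult[of h h'] by blast
  then show "set (letters w) \<subseteq> G"
    using assms by (auto simp: carrier_free_algebra plus_fword_def)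
qed

lemma one_in_free_algebra [simp]: "1 \<in> carrier (free_algebra G)"
  using scal_in_free_algebra[of 1] by (simp add: scal_def)

lemma zero_in_free_algebra [simp]: "0 \<in> carrier (free_algebra G)"
  by (simp add: carrier_free_algebra)

lemma power_in_free_algebra [simp]:
  "h \<in> carrier (free_algebra G) \<Longrightarrow> h ^ n \<in> carrier (free_algebra G)"
  by (induction n) auto

lemma sum_in_free_algebra [simp]:
  "(\<And>s. s \<in> S \<Longrightarrow> h s \<in> carrier (free_algebra G)) \<Longrightarrow> sum h S \<in> carrier (free_algebra G)"
  by (induction S rule: infinite_finite_induct) auto

lemma ring_free_algebra: "ring (free_algebra G :: ('k::field, 'g fword \<Rightarrow>\<^sub>0 'k) module)"
proof (intro ringI abelian_groupI monoidI)
  fix x :: "'g fword \<Rightarrow>\<^sub>0 'k" assume "x \<in> carrier (free_algebra G)"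
  then show "\<exists>y\<in>carrier (free_algebra G). y \<oplus>\<^bsub>free_algebra G\<^esub> x = \<zero>\<^bsub>free_algebra G\<^esub>"
    by (intro bexI[of _ "- x"]) auto
qed (auto simp: algebra_simps)

lemma single_FWord_Cons:
  "Poly_Mapping.single (FWord (g # w)) c = gen g * Poly_Mapping.single (FWord w) c"
  by (simp add: gen_def mult_single plus_fword_def)

lemma single_eq_scal_mult: "Poly_Mapping.single w c = scal c * Poly_Mapping.single w 1"
  by (simp add: scal_def mult_single)

text \<open>The case \<open>single\<close> is restricted to keys of \<open>h\<close>, so that for an
  element of \<open>free_algebra G\<close> only words over \<open>G\<close> have to be
  treated.\<close>

lemma poly_mapping_additive_induct [case_names zero single add]:
  assumes zero: "P 0"
    and single: "\<And>k c. k \<in> Poly_Mapping.keys h \<Longrightarrow> P (Poly_Mapping.single k c)"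
    and add: "\<And>f g. P f \<Longrightarrow> P g \<Longrightarrow> P (f + g)"
  shows "P (h :: 'a \<Rightarrow>\<^sub>0 'b::comm_monoid_add)"
  using single
proof (induction h rule: update_induct)
  case const
  show ?case by (rule zero)
next
  case (update f k c)
  have "Poly_Mapping.update k c f = f + Poly_Mapping.single k c"
    using update.hyps
    by (intro poly_mapping_eqI) (auto simp: lookup_update lookup_add lookup_single in_keys_iff when_def)
  moreover have "P f" "P (Poly_Mapping.single k c)"
    using update by (auto simp: keys_update)
  ultimately show ?case by (simp add: add)
qed

text \<open>A word is built from \<open>1\<close> by multiplying with generators on the left. This
  fits both uses: a span stable under left multiplication, and an action whose first letter acts
  first.\<close>

lemma free_algebra_induct [consumes 1, case_names zero add gen smult one]:
  fixes h :: "'g fword \<Rightarrow>\<^sub>0 'k::field"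
  assumes h: "h \<in> carrier (free_algebra G)"
    and zero: "P 0"
    and add: "\<And>h h'. h \<in> carrier (free_algebra G) \<Longrightarrow> h' \<in> carrier (free_algebra G) \<Longrightarrow>
      P h \<Longrightarrow> P h' \<Longrightarrow> P (h + h')"
    and gen: "\<And>g h. g \<in> G \<Longrightarrow> h \<in> carrier (free_algebra G) \<Longrightarrow> P h \<Longrightarrow> P (gen g * h)"
    and smult: "\<And>c h. h \<in> carrier (free_algebra G) \<Longrightarrow> P h \<Longrightarrow> P (scal c * h)"
    and one: "P 1"
  shows "P h"
proof -
  have word: "P (Poly_Mapping.single (FWord v) 1)" if "set v \<subseteq> G" for v
    using that
  proof (induction v)
    case Nil
    then show ?case using one by (simp add: zero_fword_def[symmetric])
  next
    case (Cons g v)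
    then show ?case
      unfolding single_FWord_Cons by (intro gen) (auto simp: single_in_free_algebra)
  qed
  \<comment> \<open>Membership is carried along because the hypothesis \<open>add\<close> asks for
    it.\<close>
  have "h \<in> carrier (free_algebra G) \<and> P h"
  proof (induction h rule: poly_mapping_additive_induct)
    case (single w c)
    then have "set (letters w) \<subseteq> G" using h by (simp add: carrier_free_algebra)
    then show ?case
      using word[of "letters w"] by (subst (2) single_eq_scal_mult) (auto intro: smult single_in_free_algebra)
  qed (auto intro: zero add)
  then show ?thesis ..
qed

section \<open>The quotient by the relation ideal\<close>

locale presentation =
  fixes G :: "'g set" and rels :: "('g fword \<Rightarrow>\<^sub>0 'k::field) set"
  assumes rels_closed: "rels \<subseteq> carrier (free_algebra G)"
begin

abbreviation "P \<equiv> presented G rels"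

definition cls :: "('g fword \<Rightarrow>\<^sub>0 'k) \<Rightarrow> ('g fword \<Rightarrow>\<^sub>0 'k) set" where
  "cls h = rel_ideal G rels +>\<^bsub>free_algebra G\<^esub> h"

lemma ideal_rel_ideal: "ideal (rel_ideal G rels) (free_algebra G)"
  unfolding rel_ideal_def by (rule ring.genideal_ideal[OF ring_free_algebra rels_closed])

lemma presented_simps:
  "carrier P = carrier (free_algebra G Quot rel_ideal G rels)"
  "monoid.mult P = monoid.mult (free_algebra G Quot rel_ideal G rels)"
  "one P = one (free_algebra G Quot rel_ideal G rels)"
  "add P = add (free_algebra G Quot rel_ideal G rels)"
  "c \<odot>\<^bsub>P\<^esub> u = cls (scal c) \<otimes>\<^bsub>P\<^esub> u"
  by (simp_all add: presented_def Let_def cls_def)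

lemma cls_hom: "cls \<in> ring_hom (free_algebra G) (free_algebra G Quot rel_ideal G rels)"
  using ideal.rcos_ring_hom[OF ideal_rel_ideal] by (simp add: cls_def[abs_def])

lemma cls_add:
  "h \<in> carrier (free_algebra G) \<Longrightarrow> h' \<in> carrier (free_algebra G) \<Longrightarrow>
    cls (h + h') = cls h \<oplus>\<^bsub>P\<^esub> cls h'"
  using ring_hom_add[OF cls_hom] by (simp add: presented_simps)

lemma cls_mult:
  "h \<in> carrier (free_algebra G) \<Longrightarrow> h' \<in> carrier (free_algebra G) \<Longrightarrow>
    cls (h * h') = cls h \<otimes>\<^bsub>P\<^esub> cls h'"
  using ring_hom_mult[OF cls_hom] by (simp add: presented_simps)

lemma cls_one: "cls 1 = \<one>\<^bsub>P\<^esub>"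
  using ring_hom_one[OF cls_hom] by (simp add: presented_simps)

lemma cls_zero: "cls 0 = \<zero>\<^bsub>P\<^esub>"
proof -
  interpret ideal "rel_ideal G rels" "free_algebra G" by (rule ideal_rel_ideal)
  have "rel_ideal G rels +>\<^bsub>free_algebra G\<^esub> \<zero>\<^bsub>free_algebra G\<^esub> = rel_ideal G rels"
    by (rule a_coset_add_zero) (rule a_subset)
  then show ?thesis by (simp add: cls_def presented_def Let_def FactRing_def)
qed

lemma cls_smult:
  "h \<in> carrier (free_algebra G) \<Longrightarrow> cls (scal c * h) = c \<odot>\<^bsub>P\<^esub> cls h"
  by (simp add: cls_mult presented_simps(5))

lemma cls_power:
  "h \<in> carrier (free_algebra G) \<Longrightarrow> cls (h ^ n) = cls h [^]\<^bsub>P\<^esub> n"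
proof (induction n)
  case (Suc n)
  then show ?case
    by (metis cls_mult nat_pow_Suc power_Suc2 power_in_free_algebra)
qed (simp add: cls_one)

lemma carrier_presented: "carrier P = cls ` carrier (free_algebra G)"
  by (auto simp: presented_simps FactRing_def A_RCOSETS_def RCOSETS_def cls_def a_r_coset_def)

lemma cls_closed [simp]: "h \<in> carrier (free_algebra G) \<Longrightarrow> cls h \<in> carrier P"
  by (simp add: carrier_presented)

lemma gen_class_eq: "gen_class G rels g = cls (gen g)"
  by (simp add: gen_class_def cls_def)

lemma cls_eqD:
  assumes "h \<in> carrier (free_algebra G)" "h' \<in> carrier (free_algebra G)" "cls h = cls h'"
  shows "h - h' \<in> rel_ideal G rels"
proof -
  interpret ideal "rel_ideal G rels" "free_algebra G" by (rule ideal_rel_ideal)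
  have "h \<in> rel_ideal G rels +>\<^bsub>free_algebra G\<^esub> h'"
    using a_rcos_self[OF assms(1)] assms(3) by (simp add: cls_def)
  then show ?thesis by (auto simp: a_r_coset_def r_coset_def)
qed

lemma cls_eq_of_rel:
  assumes "h - h' \<in> rels" "h' \<in> carrier (free_algebra G)"
  shows "cls h = cls h'"
proof -
  interpret ideal "rel_ideal G rels" "free_algebra G" by (rule ideal_rel_ideal)
  have "h - h' \<in> rel_ideal G rels"
    using ring.genideal_self[OF ring_free_algebra rels_closed] assms by (auto simp: rel_ideal_def)
  then have "h \<in> cls h'"
    unfolding cls_def a_r_coset_def r_coset_def by (auto intro!: bexI[of _ "h - h'"])
  then show ?thesis
    unfolding cls_def by (intro a_repr_independence'[symmetric]) (use assms in auto)
qed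

lemma linear_functional_descends:
  fixes \<Phi> :: "('g fword \<Rightarrow>\<^sub>0 'k) \<Rightarrow> 'k"
  assumes add: "\<And>h h'. \<Phi> (h + h') = \<Phi> h + \<Phi> h'"
    and smult: "\<And>c h. \<Phi> (scal c * h) = c * \<Phi> h"
    and vanish: "\<And>h. h \<in> rel_ideal G rels \<Longrightarrow> \<Phi> h = 0"
  obtains \<phi> where "linear_functional P \<phi>"
    "\<And>h. h \<in> carrier (free_algebra G) \<Longrightarrow> \<phi> (cls h) = \<Phi> h"
proof
  \<comment> \<open>An arbitrary representative is chosen; two of them differ by an element of the
    ideal, where the functional vanishes.\<close>
  define \<phi> where "\<phi> u = \<Phi> (SOME h. h \<in> carrier (free_algebra G) \<and> cls h = u)" for u
  show eq: "\<phi> (cls h) = \<Phi> h" if h: "h \<in> carrier (free_algebra G)" for h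
  proof -
    define h' where "h' = (SOME h'. h' \<in> carrier (free_algebra G) \<and> cls h' = cls h)"
    have "h' \<in> carrier (free_algebra G) \<and> cls h' = cls h"
      unfolding h'_def by (rule someI[of _ h]) (use h in simp)
    then have "\<Phi> (h' - h) = 0" by (intro vanish cls_eqD) (use h in auto)
    then have "\<Phi> h' = \<Phi> h" using add[of "h' - h" h] by simp
    then show ?thesis by (simp add: \<phi>_def h'_def)
  qed
  show "linear_functional P \<phi>"
    unfolding linear_functional_def carrier_presented
    by (auto simp: cls_add[symmetric] cls_smult[symmetric] eq add smult)
qed

end

section \<open>The monomial basis of the quantum plane or Jordan plane\<close>

\<comment> \<open>Otherwise the simplifier turns the index 1 of the letters into \<open>Suc 0\<close>.\<close>
declare One_nat_def [simp del]

text \<open>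
  The transpose of left multiplication by \<open>x\<^sub>1, x\<^sub>2\<close> on the expected basis
  \<open>x\<^sub>1\<^sup>a x\<^sub>2\<^sup>b\<close>, acting on coefficient functions from the right.
\<close>

definition letter_act :: "'k::field \<Rightarrow> 'k \<Rightarrow> letter \<Rightarrow> (nat \<Rightarrow> nat \<Rightarrow> 'k) \<Rightarrow> nat \<Rightarrow> nat \<Rightarrow> 'k" where
  "letter_act q r l f =
     (if l = LX 1 then \<lambda>a b. f (Suc a) b
      else if l = LX 2 then \<lambda>a b. q ^ a * f a (Suc b) + r * q_int q a * f (Suc a) b
      else f)"

text \<open>The linear extension of the action of words. \<open>fold\<close> lets the first letter
  act first, as a right action requires.\<close>

definition free_act ::
    "'k::field \<Rightarrow> 'k \<Rightarrow> (letter fword \<Rightarrow>\<^sub>0 'k) \<Rightarrow> (nat \<Rightarrow> nat \<Rightarrow> 'k) \<Rightarrow> nat \<Rightarrow> nat \<Rightarrow> 'k" where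
  "free_act q r h f a b =
     (\<Sum>w\<in>Poly_Mapping.keys h. Poly_Mapping.lookup h w * fold (letter_act q r) (letters w) f a b)"

lemma fold_letter_act_add:
  "fold (letter_act q r) w (\<lambda>a b. f a b + g a b) =
    (\<lambda>a b. fold (letter_act q r) w f a b + fold (letter_act q r) w g a b)"
proof (induction w arbitrary: f g)
  case (Cons l w)
  have "letter_act q r l (\<lambda>a b. f a b + g a b) =
      (\<lambda>a b. letter_act q r l f a b + letter_act q r l g a b)"
    by (auto simp: letter_act_def fun_eq_iff algebra_simps)
  then show ?case by (simp add: Cons)
qed simp

lemma fold_letter_act_smult:
  "fold (letter_act q r) w (\<lambda>a b. c * f a b) = (\<lambda>a b. c * fold (letter_act q r) w f a b)"
proof (induction w arbitrary: f)
  case (Cons l w)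
  have "letter_act q r l (\<lambda>a b. c * f a b) = (\<lambda>a b. c * letter_act q r l f a b)"
    by (auto simp: letter_act_def fun_eq_iff algebra_simps)
  then show ?case by (simp add: Cons)
qed simp

lemma free_act_add_fun:
  "free_act q r h (\<lambda>a b. f a b + g a b) = (\<lambda>a b. free_act q r h f a b + free_act q r h g a b)"
  by (simp add: free_act_def fun_eq_iff fold_letter_act_add algebra_simps sum.distrib)

lemma free_act_smult_fun:
  "free_act q r h (\<lambda>a b. c * f a b) = (\<lambda>a b. c * free_act q r h f a b)"
  by (simp add: free_act_def fun_eq_iff fold_letter_act_smult algebra_simps sum_distrib_left)

lemma free_act_zero_fun: "free_act q r h (\<lambda>a b. 0) = (\<lambda>a b. 0)"
  using free_act_smult_fun[of q r h 0 "\<lambda>a b. 0"] by simp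

lemma free_act_zero: "free_act q r 0 f = (\<lambda>a b. 0)"
  by (simp add: free_act_def fun_eq_iff)

lemma free_act_single:
  "free_act q r (Poly_Mapping.single w c) f = (\<lambda>a b. c * fold (letter_act q r) (letters w) f a b)"
  by (auto simp: free_act_def fun_eq_iff)

lemma free_act_add:
  "free_act q r (h + h') f = (\<lambda>a b. free_act q r h f a b + free_act q r h' f a b)"
  unfolding free_act_def fun_eq_iff
  by (intro allI setsum_keys_plus_distrib) (simp_all add: algebra_simps)

lemma free_act_one: "free_act q r 1 f = f"
  using free_act_single[of q r 0 1 f] by (simp add: zero_fword_def flip: single_one)

lemma free_act_uminus: "free_act q r (- h) f = (\<lambda>a b. - free_act q r h f a b)"
  using free_act_add[of q r h "- h" f] by (simp add: free_act_zero fun_eq_iff eq_neg_iff_add_eq_0 add.commute)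

lemma free_act_diff:
  "free_act q r (h - h') f = (\<lambda>a b. free_act q r h f a b - free_act q r h' f a b)"
  using free_act_add[of q r h "- h'" f] by (simp add: free_act_uminus)

lemma free_act_gen_mult: "free_act q r (gen l * h) f = free_act q r h (letter_act q r l f)"
  by (induction h rule: poly_mapping_additive_induct)
    (simp_all add: free_act_zero free_act_add distrib_left free_act_single gen_def mult_single
      plus_fword_def)

lemma free_act_scal_mult: "free_act q r (scal c * h) f = (\<lambda>a b. c * free_act q r h f a b)"
  by (induction h rule: poly_mapping_additive_induct)
    (simp_all add: free_act_zero free_act_add distrib_left free_act_single scal_def mult_single
      mult.assoc)

lemma free_act_mult: "free_act q r (h * h') f = free_act q r h' (free_act q r h f)"
proof -
  \<comment> \<open>Every letter acts, those other than \<open>LX 1\<close> and \<open>LX 2\<close>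
    as the identity, so the induction may run over the free algebra on all letters.\<close>
  have "h \<in> carrier (free_algebra UNIV)" by (simp add: carrier_free_algebra)
  then show ?thesis
    by (induction h arbitrary: f rule: free_algebra_induct)
      (simp_all add: free_act_zero free_act_zero_fun free_act_add free_act_add_fun distrib_right
        free_act_gen_mult free_act_scal_mult free_act_smult_fun free_act_one mult.assoc)
qed

lemma free_act_gen: "free_act q r (gen l) f = letter_act q r l f"
  using free_act_gen_mult[of q r l 1 f] by (simp add: free_act_one)

lemma free_act_x1_power: "free_act q r (gen (LX 1) ^ n) f = (\<lambda>a b. f (a + n) b)"
  by (induction n arbitrary: f)
    (simp_all add: free_act_one free_act_gen_mult letter_act_def)

text \<open>In the row \<open>a = 0\<close> the weight \<open>q^a\<close> is \<open>1\<close> and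
  \<open>[a]_q\<close> vanishes, so \<open>x2\<close> acts there as a pure shift.\<close>

lemma free_act_x2_power_0: "free_act q r (gen (LX 2) ^ n) f 0 b = f 0 (b + n)"
  by (induction n arbitrary: f b)
    (simp_all add: free_act_one free_act_gen_mult letter_act_def q_int_def)

text \<open>First \<open>x1^a\<close> moves the value at \<open>(a, b)\<close> into the row
  \<open>0\<close>, then \<open>x2^b\<close> moves it to the origin. Evaluation at the origin thus
  pairs a function with a monomial.\<close>

lemma free_act_x_monomial:
  "free_act q r (gen (LX 1) ^ a * gen (LX 2) ^ b) f 0 0 = f a b"
  by (simp add: free_act_mult free_act_x1_power free_act_x2_power_0)

text \<open>Splitting off the first summand, not the last, gives the identity by which
  \<open>x2 x1\<close> and \<open>q x1 x2 + r x1^2\<close> act alike: it compares the coefficients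
  of \<open>f (a + 2) b\<close>.\<close>

lemma q_int_Suc: "q_int q (Suc n) = 1 + q * q_int q n"
  by (simp add: q_int_def sum.lessThan_Suc_shift sum_distrib_left del: sum.lessThan_Suc)

lemma free_act_x_relation: "free_act (q_of F) (r_of F) (x_relation F) f = (\<lambda>a b. 0)"
  by (simp add: x_relation_def free_act_diff free_act_add mult.assoc free_act_gen_mult
      free_act_scal_mult free_act_gen power2_eq_square letter_act_def fun_eq_iff q_int_Suc
      algebra_simps)

section \<open>Descent of the action to \<open>R\<close>, and the basis of \<open>R\<close>\<close>

lemma x_relation_closed: "{x_relation F} \<subseteq> carrier (free_algebra x_letters)"
  by (simp add: x_relation_def x_letters_def)

interpretation R: presentation x_letters "{x_relation F}" for F :: "'k::field family"
  by standard (rule x_relation_closed)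

lemma free_act_rel_ideal:
  assumes "h \<in> rel_ideal x_letters {x_relation F}"
  shows "free_act (q_of F) (r_of F) h f = (\<lambda>a b. 0)"
proof -
  \<comment> \<open>Quantifying over all \<open>f\<close> makes the annihilator two-sided:
    \<open>k * h\<close> acts as \<open>h\<close> on the image of \<open>f\<close> under
    \<open>k\<close>, and \<open>h * k\<close> acts as \<open>k\<close> on zero.\<close>
  let ?N = "{h \<in> carrier (free_algebra x_letters). \<forall>f. free_act (q_of F) (r_of F) h f = (\<lambda>a b. 0)}"
  have "ideal ?N (free_algebra x_letters)"
  proof (rule idealI)
    show "subgroup ?N (add_monoid (free_algebra x_letters))"
    proof (rule group.subgroupI)
      show "Group.group (add_monoid (free_algebra x_letters))"
        by (rule abelian_group.a_group[OF ring.is_abelian_group[OF ring_free_algebra]])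
    next
      fix h assume h: "h \<in> ?N"
      have "inv\<^bsub>add_monoid (free_algebra x_letters)\<^esub> h = - h"
        unfolding a_inv_def[symmetric]
        by (rule abelian_group.minus_equality[OF ring.is_abelian_group[OF ring_free_algebra]])
          (use h in auto)
      then show "inv\<^bsub>add_monoid (free_algebra x_letters)\<^esub> h \<in> ?N"
        using h by (simp add: free_act_uminus)
    qed (auto simp: free_act_zero free_act_add intro: exI[of _ 0])
  qed (auto simp: ring_free_algebra free_act_mult free_act_zero_fun)
  then have "rel_ideal x_letters {x_relation F} \<subseteq> ?N"
    unfolding rel_ideal_def using x_relation_closed
    by (intro ring.genideal_minimal[OF ring_free_algebra]) (auto simp: free_act_x_relation)
  then show ?thesis using assms by auto
qed

lemma (in k_alg) mult_lincomb_in_span: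
  assumes e: "\<And>i. e i \<in> carrier A" and z: "z \<in> carrier A"
    and ze: "\<And>i. z \<otimes> e i \<in> range (lincomb A e)"
  shows "z \<otimes> lincomb A e \<theta> \<in> range (lincomb A e)"
proof -
  have "z \<otimes> lincomb A e \<theta> =
      (\<Oplus>i\<in>Poly_Mapping.keys \<theta>. z \<otimes> (Poly_Mapping.lookup \<theta> i \<odot> e i))"
    unfolding lincomb_def using e z by (intro finsum_rdistr) auto
  also have "\<dots> \<in> range (lincomb A e)"
  proof (rule finsum_in_span[OF e])
    fix i
    obtain \<theta>' where "z \<otimes> e i = lincomb A e \<theta>'" using ze by blast
    then show "z \<otimes> (Poly_Mapping.lookup \<theta> i \<odot> e i) \<in> range (lincomb A e)"
      using e z by (simp add: smult_mult_right lincomb_smult[symmetric])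
  qed simp
  finally show ?thesis .
qed

definition xR_monomial :: "'k::field family \<Rightarrow> nat \<times> nat \<Rightarrow> (letter fword \<Rightarrow>\<^sub>0 'k) set" where
  "xR_monomial F = (\<lambda>(a, b). xR F 1 [^]\<^bsub>R_alg F\<^esub> a \<otimes>\<^bsub>R_alg F\<^esub> xR F 2 [^]\<^bsub>R_alg F\<^esub> b)"

text \<open>The span contains \<open>1\<close> and is stable under left multiplication by both
  generators; for \<open>x1\<close> this is a shift of the exponent, for \<open>x2\<close> it is
  \<open>commute_power\<close>. The dual family for independence is provided by
  \<open>free_act\<close>.\<close>

lemma is_basis_xR_monomial:
  fixes F :: "'k::field family"
  assumes "k_algebra (R_alg F)"
  shows "is_basis (R_alg F) (xR_monomial F)"
proof -
  interpret k_alg "R_alg F" by standard (rule assms)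
  let ?e = "xR_monomial F"
  have gens: "(gen (LX 1) :: letter fword \<Rightarrow>\<^sub>0 'k) \<in> carrier (free_algebra x_letters)"
      "(gen (LX 2) :: letter fword \<Rightarrow>\<^sub>0 'k) \<in> carrier (free_algebra x_letters)"
    by (simp_all add: x_letters_def)
  have x: "xR F s = R.cls F (gen (LX s))" for s
    by (simp add: xR_def R.gen_class_eq)
  have [simp]: "xR F 1 \<in> carrier (R_alg F)" "xR F 2 \<in> carrier (R_alg F)"
    using gens by (simp_all add: x R_alg_def)
  have e [simp]: "?e i \<in> carrier (R_alg F)" for i
    by (cases i) (simp add: xR_monomial_def)
  have rel: "xR F 2 \<otimes>\<^bsub>R_alg F\<^esub> xR F 1 =
      q_of F \<odot>\<^bsub>R_alg F\<^esub> (xR F 1 \<otimes>\<^bsub>R_alg F\<^esub> xR F 2) \<oplus>\<^bsub>R_alg F\<^esub>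
      r_of F \<odot>\<^bsub>R_alg F\<^esub> (xR F 1 \<otimes>\<^bsub>R_alg F\<^esub> xR F 1)"
  proof -
    have "R.cls F (gen (LX 2) * gen (LX 1)) =
        R.cls F (scal (q_of F) * (gen (LX 1) * gen (LX 2)) + scal (r_of F) * (gen (LX 1) * gen (LX 1)))"
      using gens by (intro R.cls_eq_of_rel)
        (auto simp: x_relation_def mult.assoc power2_eq_square)
    then show ?thesis
      using gens by (simp add: x R.cls_add R.cls_mult R.presented_simps(5) R_alg_def)
  qed
  have in_span: "?e i \<in> range (lincomb (R_alg F) ?e)" for i
    using lincomb_single[of ?e i 1] by (metis e rangeI smult_one)
  have x1: "xR F 1 \<otimes>\<^bsub>R_alg F\<^esub> ?e i \<in> range (lincomb (R_alg F) ?e)" for i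
  proof -
    obtain a b where "i = (a, b)" by force
    then have "xR F 1 \<otimes>\<^bsub>R_alg F\<^esub> ?e i = ?e (Suc a, b)"
      by (simp add: xR_monomial_def m_assoc[symmetric] nat_pow_Suc2[symmetric] del: nat_pow_Suc)
    then show ?thesis using in_span by simp
  qed
  have x2: "xR F 2 \<otimes>\<^bsub>R_alg F\<^esub> ?e i \<in> range (lincomb (R_alg F) ?e)" for i
  proof -
    obtain a b where i: "i = (a, b)" by force
    have "xR F 2 \<otimes>\<^bsub>R_alg F\<^esub> ?e i =
        (xR F 2 \<otimes>\<^bsub>R_alg F\<^esub> xR F 1 [^]\<^bsub>R_alg F\<^esub> a) \<otimes>\<^bsub>R_alg F\<^esub> xR F 2 [^]\<^bsub>R_alg F\<^esub> b"
      by (simp add: i xR_monomial_def m_assoc)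
    also have "\<dots> = q_of F ^ a \<odot>\<^bsub>R_alg F\<^esub> ?e (a, Suc b) \<oplus>\<^bsub>R_alg F\<^esub>
        (r_of F * q_int (q_of F) a) \<odot>\<^bsub>R_alg F\<^esub> ?e (Suc a, b)"
      unfolding commute_power[OF _ _ rel, simplified]
      by (simp add: xR_monomial_def l_distr smult_mult_left m_assoc nat_pow_Suc2[symmetric]
          del: nat_pow_Suc)
    also have "\<dots> \<in> range (lincomb (R_alg F) ?e)"
      using lincomb_add[of ?e] lincomb_single[of ?e] e by (metis rangeI)
    finally show ?thesis .
  qed
  \<comment> \<open>The indicator of \<open>i\<close>: by \<open>free_act_x_monomial\<close>,
    letting a monomial act on it and evaluating at \<open>(0, 0)\<close> gives \<open>1\<close> for
    the monomial of index \<open>i\<close> and \<open>0\<close> for all others.\<close>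
  define D :: "nat \<times> nat \<Rightarrow> nat \<Rightarrow> nat \<Rightarrow> 'k" where "D i = (\<lambda>a b. of_bool (i = (a, b)))" for i
  let ?\<Phi> = "\<lambda>i h. free_act (q_of F) (r_of F) h (D i) 0 0"
  have "\<exists>\<phi>. linear_functional (R_alg F) \<phi> \<and>
      (\<forall>h\<in>carrier (free_algebra x_letters). \<phi> (R.cls F h) = ?\<Phi> i h)" for i
  proof -
    obtain \<phi> where "linear_functional (R.P F) \<phi>"
        "\<And>h. h \<in> carrier (free_algebra x_letters) \<Longrightarrow> \<phi> (R.cls F h) = ?\<Phi> i h"
      by (rule R.linear_functional_descends[of "?\<Phi> i" F])
        (simp_all add: free_act_add free_act_scal_mult free_act_rel_ideal)
    then show ?thesis by (auto simp: R_alg_def)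
  qed
  then obtain \<phi> where \<phi>: "\<And>i. linear_functional (R_alg F) (\<phi> i)"
      "\<And>i h. h \<in> carrier (free_algebra x_letters) \<Longrightarrow> \<phi> i (R.cls F h) = ?\<Phi> i h"
    by metis
  show ?thesis
  proof (rule is_basisI[where f = \<phi>])
    have "R.cls F h \<in> range (lincomb (R_alg F) ?e)" if "h \<in> carrier (free_algebra x_letters)" for h
      using that
    proof (induction h rule: free_algebra_induct)
      case zero
      then show ?case
        using lincomb_zero[of ?e] by (auto simp: R.cls_zero R_alg_def[symmetric] image_iff intro: exI[of _ 0])
    next
      case (add h h')
      then show ?case
        by (auto simp: R.cls_add R_alg_def[symmetric] lincomb_add[symmetric])
    next
      case (gen g h)
      obtain s where s: "g = LX s" "s \<in> {1, 2}"
        using gen(1) by (auto simp: x_letters_def)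
      obtain \<theta> where "R.cls F h = lincomb (R_alg F) ?e \<theta>" using gen(3) by blast
      then have "R.cls F (gen g * h) = xR F s \<otimes>\<^bsub>R_alg F\<^esub> lincomb (R_alg F) ?e \<theta>"
        using gen by (simp add: s x R.cls_mult R_alg_def)
      then show ?case
        using s(2) x1 x2 by (auto intro: mult_lincomb_in_span)
    next
      case (smult c h)
      then show ?case
        by (auto simp: R.cls_smult R_alg_def[symmetric] lincomb_smult[symmetric])
    next
      case one
      show ?case
        using in_span[of "(0, 0)"] by (simp add: R.cls_one R_alg_def[symmetric] xR_monomial_def)
    qed
    then show "carrier (R_alg F) \<subseteq> range (lincomb (R_alg F) ?e)"
      by (auto simp: R_alg_def R.carrier_presented)
  next
    show "linear_functional (R_alg F) (\<phi> i)" for i by (rule \<phi>)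
    show "\<phi> i (?e j) = of_bool (i = j)" for i j
    proof -
      obtain a b where j: "j = (a, b)" by force
      have "?e j = R.cls F (gen (LX 1) ^ a * gen (LX 2) ^ b)"
        using gens by (simp add: j xR_monomial_def x R.cls_mult R.cls_power R_alg_def)
      then show ?thesis
        using gens by (simp add: \<phi> free_act_x_monomial D_def j)
    qed
  qed simp
qed

section \<open>Free extensions\<close>

text \<open>Freeness of \<open>B\<close> over \<open>R\<close> yields a basis indexed by
  \<open>((a, b), (c, d))\<close>, whereas normal forms are indexed by \<open>(a, b, c, d)\<close>.
  The old coordinates, read at \<open>\<pi> j\<close>, are a dual family for the reindexed
  one.\<close>

lemma (in k_alg) is_basis_reindex:
  fixes e :: "'i \<Rightarrow> 'a" and \<pi> :: "'j \<Rightarrow> 'i"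
  assumes e: "is_basis A e" and \<pi>: "bij \<pi>"
  shows "is_basis A (\<lambda>j. e (\<pi> j))"
proof (rule is_basisI)
  note closed = is_basis_closed[OF e]
  show "e (\<pi> j) \<in> carrier A" for j by (rule closed)
  have "c \<odot> e i \<in> range (lincomb A (\<lambda>j. e (\<pi> j)))" for c i
  proof -
    have "c \<odot> e i = lincomb A (\<lambda>j. e (\<pi> j)) (Poly_Mapping.single (inv_into UNIV \<pi> i) c)"
      using \<pi> closed by (simp add: lincomb_single bij_is_surj surj_f_inv_f)
    then show ?thesis by simp
  qed
  then have "lincomb A e \<theta> \<in> range (lincomb A (\<lambda>j. e (\<pi> j)))" for \<theta>
    unfolding lincomb_def[of A e] using closed by (intro finsum_in_span) auto
  then show "carrier A \<subseteq> range (lincomb A (\<lambda>j. e (\<pi> j)))"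
    using lincomb_coord[OF e] by (metis subsetI)
  show "linear_functional A (\<lambda>b. Poly_Mapping.lookup (coord A e b) (\<pi> j))" for j
    by (rule linear_functional_coord[OF e])
  show "Poly_Mapping.lookup (coord A e (e (\<pi> k))) (\<pi> j) = of_bool (j = k)" for j k
    using \<pi> by (auto simp: coord_basis[OF e] lookup_single when_def bij_def inj_eq)
qed

locale k_alg_hom = R: k_alg R + B: k_alg B
  for R :: "('k::field, 'r) module" and B :: "('k, 'b) module" +
  fixes h :: "'r \<Rightarrow> 'b"
  assumes hom: "h \<in> alg_hom R B"
begin

lemma ring_hom: "h \<in> ring_hom R B"
  using hom by (simp add: alg_hom_def)

lemma hom_closed [simp]: "x \<in> carrier R \<Longrightarrow> h x \<in> carrier B"
  by (rule ring_hom_closed[OF ring_hom])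

lemma hom_smult: "x \<in> carrier R \<Longrightarrow> h (c \<odot>\<^bsub>R\<^esub> x) = c \<odot>\<^bsub>B\<^esub> h x"
  using hom by (simp add: alg_hom_def)

lemma hom_zero [simp]: "h \<zero>\<^bsub>R\<^esub> = \<zero>\<^bsub>B\<^esub>"
  by (rule ring_hom_zero[OF ring_hom R.ring_axioms B.ring_axioms])

lemma hom_power: "x \<in> carrier R \<Longrightarrow> h (x [^]\<^bsub>R\<^esub> (n::nat)) = h x [^]\<^bsub>B\<^esub> n"
  by (induction n) (simp_all add: ring_hom_one[OF ring_hom] ring_hom_mult[OF ring_hom])

lemma hom_finsum:
  assumes "finite S" "g \<in> S \<rightarrow> carrier R"
  shows "h (\<Oplus>\<^bsub>R\<^esub>s\<in>S. g s) = (\<Oplus>\<^bsub>B\<^esub>s\<in>S. h (g s))"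
  using assms by (induction S) (auto simp: ring_hom_add[OF ring_hom] Pi_iff)

lemma hom_lincomb_mult:
  assumes e: "\<And>i. e i \<in> carrier R" and z: "z \<in> carrier B"
  shows "h (lincomb R e \<theta>) \<otimes>\<^bsub>B\<^esub> z = lincomb B (\<lambda>i. h (e i) \<otimes>\<^bsub>B\<^esub> z) \<theta>"
proof -
  have "h (lincomb R e \<theta>) \<otimes>\<^bsub>B\<^esub> z =
      (\<Oplus>\<^bsub>B\<^esub>i\<in>Poly_Mapping.keys \<theta>. h (Poly_Mapping.lookup \<theta> i \<odot>\<^bsub>R\<^esub> e i) \<otimes>\<^bsub>B\<^esub> z)"
    unfolding lincomb_def using e z
    by (subst hom_finsum) (auto intro!: B.finsum_ldistr)
  then show ?thesis
    using e z by (simp add: lincomb_def hom_smult B.smult_mult_left)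
qed

text \<open>Coefficients indexed by pairs \<open>(i, n)\<close> split into rows, one for each
  \<open>n\<close>. Combining row \<open>n\<close> in \<open>R\<close> gives the coefficient of
  \<open>E n\<close> in the expansion over \<open>R\<close>, and both expansions are unique.\<close>

lemma is_basis_free_left_basis:
  fixes e :: "'i \<Rightarrow> 'r" and E :: "'n \<Rightarrow> 'b"
  assumes e: "is_basis R e" and E: "free_left_basis R B h E"
  shows "is_basis B (\<lambda>(i, n). h (e i) \<otimes>\<^bsub>B\<^esub> E n)"
  unfolding is_basis_def
proof (intro conjI allI ballI)
  let ?eE = "\<lambda>(i, n). h (e i) \<otimes>\<^bsub>B\<^esub> E n"
  note e_closed [simp] = R.is_basis_closed[OF e]
  have E_closed [simp]: "E n \<in> carrier B" for n
    using E by (simp add: free_left_basis_def)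
  show closed: "?eE j \<in> carrier B" for j by (cases j) simp
  define row where
    "row \<theta> n = lincomb R e (Poly_Mapping.map_key (\<lambda>i. (i, n)) \<theta>)" for \<theta> :: "('i \<times> 'n) \<Rightarrow>\<^sub>0 'k" and n
  have row_closed [simp]: "row \<theta> n \<in> carrier R" for \<theta> n by (simp add: row_def)
  have lookup_row: "Poly_Mapping.lookup (Poly_Mapping.map_key (\<lambda>i. (i, n)) \<theta>) i =
      Poly_Mapping.lookup \<theta> (i, n)" for \<theta> :: "('i \<times> 'n) \<Rightarrow>\<^sub>0 'k" and i n
    by (simp add: map_key.rep_eq inj_on_def)
  \<comment> \<open>\<open>free_left_basis\<close> sums over exactly the non-zero coefficients, so
    the sum over a rectangle around the support is regrouped by \<open>n\<close> and then cut down
    to the non-zero rows.\<close>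
  have rows: "finite {n. row \<theta> n \<noteq> \<zero>\<^bsub>R\<^esub>} \<and> lincomb B ?eE \<theta> =
      (\<Oplus>\<^bsub>B\<^esub>n\<in>{n. row \<theta> n \<noteq> \<zero>\<^bsub>R\<^esub>}. h (row \<theta> n) \<otimes>\<^bsub>B\<^esub> E n)" for \<theta>
  proof -
    let ?I = "fst ` Poly_Mapping.keys \<theta>" and ?N = "snd ` Poly_Mapping.keys \<theta>"
    have keys: "Poly_Mapping.keys (Poly_Mapping.map_key (\<lambda>i. (i, n)) \<theta>) \<subseteq> ?I" for n
      by (force simp: in_keys_iff lookup_row)
    have outside: "row \<theta> n = \<zero>\<^bsub>R\<^esub>" if "n \<notin> ?N" for n
    proof -
      have "Poly_Mapping.map_key (\<lambda>i. (i, n)) \<theta> = 0"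
        using that by (intro poly_mapping_eqI) (force simp: lookup_row in_keys_iff)
      then show ?thesis by (simp add: row_def)
    qed
    then have sub: "{n. row \<theta> n \<noteq> \<zero>\<^bsub>R\<^esub>} \<subseteq> ?N" by auto
    have "lincomb B ?eE \<theta> =
        (\<Oplus>\<^bsub>B\<^esub>j\<in>?I \<times> ?N. Poly_Mapping.lookup \<theta> j \<odot>\<^bsub>B\<^esub> ?eE j)"
      by (rule B.lincomb_superset[OF closed]) force+
    also have "\<dots> = finsum B (\<lambda>(i, n). Poly_Mapping.lookup \<theta> (i, n) \<odot>\<^bsub>B\<^esub> (h (e i) \<otimes>\<^bsub>B\<^esub> E n)) (?I \<times> ?N)"
      by (intro B.finsum_cong') auto
    also have "\<dots> = (\<Oplus>\<^bsub>B\<^esub>n\<in>?N. \<Oplus>\<^bsub>B\<^esub>i\<in>?I. Poly_Mapping.lookup \<theta> (i, n) \<odot>\<^bsub>B\<^esub> (h (e i) \<otimes>\<^bsub>B\<^esub> E n))"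
      by (rule B.finsum_Times) auto
    also have "\<dots> = (\<Oplus>\<^bsub>B\<^esub>n\<in>?N. h (row \<theta> n) \<otimes>\<^bsub>B\<^esub> E n)"
    proof (intro B.finsum_cong')
      fix n
      show "(\<Oplus>\<^bsub>B\<^esub>i\<in>?I. Poly_Mapping.lookup \<theta> (i, n) \<odot>\<^bsub>B\<^esub> (h (e i) \<otimes>\<^bsub>B\<^esub> E n)) = h (row \<theta> n) \<otimes>\<^bsub>B\<^esub> E n"
        unfolding row_def hom_lincomb_mult[OF e_closed E_closed]
        by (subst B.lincomb_superset[OF _ _ keys]) (simp_all add: lookup_row)
    qed auto
    also have "\<dots> = (\<Oplus>\<^bsub>B\<^esub>n\<in>{n. row \<theta> n \<noteq> \<zero>\<^bsub>R\<^esub>}. h (row \<theta> n) \<otimes>\<^bsub>B\<^esub> E n)"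
      using sub by (intro B.add.finprod_mono_neutral_cong_right) auto
    finally show ?thesis
      using finite_subset[OF sub] by simp
  qed
  fix b assume b: "b \<in> carrier B"
  define Q where "Q r \<longleftrightarrow> (\<forall>n. r n \<in> carrier R) \<and> finite {n. r n \<noteq> \<zero>\<^bsub>R\<^esub>} \<and>
      b = (\<Oplus>\<^bsub>B\<^esub>n\<in>{n. r n \<noteq> \<zero>\<^bsub>R\<^esub>}. h (r n) \<otimes>\<^bsub>B\<^esub> E n)" for r
  have unique: "\<exists>!r. Q r"
    using E b by (simp add: free_left_basis_def Q_def)
  then obtain r where "Q r" by blast
  then have r_closed: "\<And>n. r n \<in> carrier R" and r_finite: "finite {n. r n \<noteq> \<zero>\<^bsub>R\<^esub>}"
      and b_eq: "b = (\<Oplus>\<^bsub>B\<^esub>n\<in>{n. r n \<noteq> \<zero>\<^bsub>R\<^esub>}. h (r n) \<otimes>\<^bsub>B\<^esub> E n)"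
    by (auto simp: Q_def)
  have "b \<in> range (lincomb B ?eE)"
    unfolding b_eq
  proof (rule B.finsum_in_span[OF closed r_finite])
    fix n
    have "h (r n) \<otimes>\<^bsub>B\<^esub> E n = h (lincomb R e (coord R e (r n))) \<otimes>\<^bsub>B\<^esub> E n"
      by (simp add: R.lincomb_coord[OF e r_closed])
    also have "\<dots> = lincomb B (\<lambda>i. ?eE (i, n)) (coord R e (r n))"
      by (simp add: hom_lincomb_mult)
    also have "\<dots> \<in> range (lincomb B ?eE)"
      unfolding lincomb_def[of B "\<lambda>i. ?eE (i, n)"]
    proof (rule B.finsum_in_span[OF closed finite_keys])
      fix i
      show "Poly_Mapping.lookup (coord R e (r n)) i \<odot>\<^bsub>B\<^esub> ?eE (i, n) \<in> range (lincomb B ?eE)"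
        by (subst B.lincomb_single[OF closed, symmetric]) (rule rangeI)
    qed
    finally show "h (r n) \<otimes>\<^bsub>B\<^esub> E n \<in> range (lincomb B ?eE)" .
  qed
  \<comment> \<open>The rows of either expansion are the coefficients over \<open>R\<close>, hence
    agree; coordinates in \<open>R\<close> then recover the entries of each row.\<close>
  moreover have "\<theta> = \<theta>'" if "b = lincomb B ?eE \<theta>" "b = lincomb B ?eE \<theta>'" for \<theta> \<theta>'
  proof -
    have "Q (row \<theta>)" "Q (row \<theta>')"
      unfolding Q_def using rows[of \<theta>] rows[of \<theta>'] that row_closed by simp_all
    then have "row \<theta> = row \<theta>'" using unique by blast
    then have "Poly_Mapping.map_key (\<lambda>i. (i, n)) \<theta> = Poly_Mapping.map_key (\<lambda>i. (i, n)) \<theta>'" for n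
      unfolding row_def fun_eq_iff by (metis R.coord_lincomb[OF e])
    then show ?thesis
      by (intro poly_mapping_eqI) (metis lookup_row surj_pair)
  qed
  ultimately show "\<exists>!\<theta>. b = lincomb B ?eE \<theta>" by blast
qed

end

text \<open>Checked family by family. It keeps all relations inside the free algebra on the four
  generators.\<close>

lemma K_set_indices:
  assumes "(c, t, l) \<in> K_set F i s" "i \<in> {1, 2}" "s \<in> {1, 2}"
  shows "t \<in> {1, 2} \<and> l \<in> {1, 2}"
  using assms by (cases F) (auto simp: K_set_def)

lemma B_relations_closed: "B_relations F \<subseteq> carrier (free_algebra xy_letters)"
proof -
  have [simp]: "gen (LX t) \<in> carrier (free_algebra xy_letters)"
      "gen (LY t) \<in> carrier (free_algebra xy_letters)" if "t \<in> {1, 2}" for t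
    using that by (auto simp: xy_letters_def)
  have "yx_relation F i s \<in> carrier (free_algebra xy_letters)" if "i \<in> {1, 2}" "s \<in> {1, 2}" for i s
    unfolding yx_relation_def using that
    by (auto intro!: diff_in_free_algebra mult_in_free_algebra sum_in_free_algebra dest: K_set_indices
        split: prod.split)
  then show ?thesis
    by (auto simp: B_relations_def x_relation_def y_relation_def)
qed

section \<open>The Pascal-type recursion for \<open>Lambda\<close>\<close>

lemma q_binom_eq_0: "k > n \<Longrightarrow> q_binom q n k = 0"
  by (induction q n k rule: q_binom.induct) auto

lemma q_binom_0_right [simp]: "q_binom q n 0 = 1"
  by (induction n) auto

text \<open>The Pascal rule for \<open>q_binom\<close>, multiplied by \<open>s^k\<close>, a power of
  \<open>p\<close> and \<open>[1]_p ... [k]_p\<close>. The summands are the two ways in which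
  \<open>y2\<close>, multiplied from the left, leads to \<open>y1^(k+1)\<close>: it passes this
  power, or it passes into \<open>y1^k\<close> and becomes a \<open>y1\<close> itself.\<close>

lemma Lambda_Suc:
  "Lambda p s (Suc v) 1 k = p ^ Suc k * Lambda p s v 1 k +
    (if k = 0 then 0 else s * q_int p k * Lambda p s v 1 (k - 1))"
proof (cases k)
  case 0
  then show ?thesis by (simp add: Lambda_def q_rising_def power_add)
next
  case (Suc j)
  \<comment> \<open>Beyond the range everything vanishes; at \<open>j = v\<close> only the second
    summand survives; inside, writing \<open>v = Suc (j + d)\<close> removes the truncated
    subtractions.\<close>
  consider "j > v" | "j = v" | d where "v = Suc (j + d)"
    by (metis less_imp_Suc_add linorder_neqE_nat)
  then show ?thesis
  proof cases
    case 3
    then show ?thesis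
      by (simp add: Suc Lambda_def q_rising_def Suc_diff_le power_add algebra_simps plus_1_eq_Suc)
  qed (auto simp: Suc Lambda_def q_rising_def q_binom_eq_0 algebra_simps plus_1_eq_Suc)
qed

section \<open>Normal forms in the double extension\<close>

interpretation B: presentation xy_letters "B_relations F" for F :: "'k::field family"
  by standard (rule B_relations_closed)

lemma letters_mem [simp]:
  "LX 1 \<in> x_letters" "LX 2 \<in> x_letters"
  "LX 1 \<in> xy_letters" "LX 2 \<in> xy_letters" "LY 1 \<in> xy_letters" "LY 2 \<in> xy_letters"
  by (simp_all add: x_letters_def xy_letters_def)

locale admissible_family =
  fixes F :: "'k::field family"
  assumes admissible: "admissible F"
begin

abbreviation "A \<equiv> B_alg F"
abbreviation "x1 \<equiv> xB F 1"
abbreviation "x2 \<equiv> xB F 2"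
abbreviation "y1 \<equiv> yB F 1"
abbreviation "y2 \<equiv> yB F 2"

text \<open>Admissibility asserts only that an embedding exists; one is fixed here so that it can
  serve as the parameter of \<open>k_alg_hom\<close>.\<close>

definition \<iota> :: "(letter fword \<Rightarrow>\<^sub>0 'k) set \<Rightarrow> (letter fword \<Rightarrow>\<^sub>0 'k) set" where
  "\<iota> = (SOME \<iota>. \<iota> (xR F 1) = xB F 1 \<and> \<iota> (xR F 2) = xB F 2 \<and>
     trimmed_double_extension (R_alg F) (B_alg F) \<iota> (yB F 1) (yB F 2))"

lemma \<iota>: "\<iota> (xR F 1) = x1" "\<iota> (xR F 2) = x2"
    "trimmed_double_extension (R_alg F) A \<iota> y1 y2"
  using someI_ex[of "\<lambda>\<iota>. \<iota> (xR F 1) = xB F 1 \<and> \<iota> (xR F 2) = xB F 2 \<and>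
     trimmed_double_extension (R_alg F) (B_alg F) \<iota> (yB F 1) (yB F 2)"] admissible
  unfolding admissible_def \<iota>_def by blast+

end

sublocale admissible_family \<subseteq> k_alg_hom "R_alg F" "B_alg F" \<iota>
  using \<iota>(3) by unfold_locales (simp_all add: trimmed_double_extension_def)

context admissible_family
begin

lemma x_closed [simp]: "x1 \<in> carrier A" "x2 \<in> carrier A"
  by (simp_all add: xB_def B.gen_class_eq B_alg_def)

lemma y_closed [simp]: "y1 \<in> carrier A" "y2 \<in> carrier A"
  by (simp_all add: yB_def B.gen_class_eq B_alg_def)

lemma xR_closed [simp]: "xR F 1 \<in> carrier (R_alg F)" "xR F 2 \<in> carrier (R_alg F)"
  by (simp_all add: xR_def R.gen_class_eq R_alg_def)

text \<open>Derived from the presentation, because the double extension provides this relation only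
  with some unspecified \<open>p12\<close> and \<open>p11\<close>.\<close>

lemma y_commute: "y2 \<otimes>\<^bsub>A\<^esub> y1 = p_of F \<odot>\<^bsub>A\<^esub> (y1 \<otimes>\<^bsub>A\<^esub> y2) \<oplus>\<^bsub>A\<^esub> s_of F \<odot>\<^bsub>A\<^esub> (y1 \<otimes>\<^bsub>A\<^esub> y1)"
proof -
  have gens: "(gen (LY 1) :: letter fword \<Rightarrow>\<^sub>0 'k) \<in> carrier (free_algebra xy_letters)"
      "(gen (LY 2) :: letter fword \<Rightarrow>\<^sub>0 'k) \<in> carrier (free_algebra xy_letters)"
    by simp_all
  have "B.cls F (gen (LY 2) * gen (LY 1)) =
      B.cls F (scal (p_of F) * (gen (LY 1) * gen (LY 2)) + scal (s_of F) * (gen (LY 1) * gen (LY 1)))"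
    using gens by (intro B.cls_eq_of_rel)
      (auto simp: B_relations_def y_relation_def mult.assoc power2_eq_square)
  then show ?thesis
    using gens by (simp add: yB_def B.gen_class_eq B.cls_add B.cls_mult B.presented_simps(5) B_alg_def)
qed

section \<open>The monomial basis of \<open>B\<close>, and \<open>NF\<close> as coordinates\<close>

definition nf :: "nat \<times> nat \<times> nat \<times> nat \<Rightarrow> (letter fword \<Rightarrow>\<^sub>0 'k) set" where
  "nf = (\<lambda>(a, b, c, d). nf_monomial F a b c d)"

lemma nf_closed [simp]: "nf j \<in> carrier A"
  by (cases j) (simp add: nf_def nf_monomial_def)

lemma \<iota>_xR_monomial: "\<iota> (xR_monomial F (a, b)) = x1 [^]\<^bsub>A\<^esub> a \<otimes>\<^bsub>A\<^esub> x2 [^]\<^bsub>A\<^esub> b"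
  by (simp add: xR_monomial_def ring_hom_mult[OF ring_hom] hom_power \<iota>)

lemma xR_monomial_basis: "is_basis (R_alg F) (xR_monomial F)"
  by (rule is_basis_xR_monomial) (rule R.k_algebra)

lemma nf_basis: "is_basis A nf"
proof -
  let ?E = "\<lambda>(i::nat, j::nat). y1 [^]\<^bsub>A\<^esub> i \<otimes>\<^bsub>A\<^esub> y2 [^]\<^bsub>A\<^esub> j"
  let ?\<pi> = "\<lambda>(a::nat, b::nat, c::nat, d::nat). ((a, b), (c, d))"
  have "free_left_basis (R_alg F) A \<iota> ?E"
    using \<iota>(3) by (simp add: trimmed_double_extension_def)
  then have "is_basis A (\<lambda>(i, n). \<iota> (xR_monomial F i) \<otimes>\<^bsub>A\<^esub> ?E n)"
    by (rule is_basis_free_left_basis[OF xR_monomial_basis])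
  moreover have "bij ?\<pi>"
    by (rule bij_betw_byWitness[where f' = "\<lambda>((a, b), (c, d)). (a, b, c, d)"]) auto
  ultimately have "is_basis A (\<lambda>j. (\<lambda>(i, n). \<iota> (xR_monomial F i) \<otimes>\<^bsub>A\<^esub> ?E n) (?\<pi> j))"
    by (rule B.is_basis_reindex)
  moreover have "(\<lambda>j. (\<lambda>(i, n). \<iota> (xR_monomial F i) \<otimes>\<^bsub>A\<^esub> ?E n) (?\<pi> j)) = nf"
    by (auto simp: fun_eq_iff nf_def nf_monomial_def \<iota>_xR_monomial B.m_assoc)
  ultimately show ?thesis by simp
qed

text \<open>The bridge from curried coefficient functions with finite support to
  \<open>poly_mapping\<close>, through which the basis property decides existence and uniqueness of
  expansions.\<close>

lemma is_expansion_iff: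
  "is_expansion F b \<theta> \<longleftrightarrow>
    (\<exists>\<tau>. \<theta> = (\<lambda>\<alpha> \<beta> \<gamma> \<delta>. Poly_Mapping.lookup \<tau> (\<alpha>, \<beta>, \<gamma>, \<delta>)) \<and> b = lincomb A nf \<tau>)"
proof -
  have lincomb: "lincomb A nf \<tau> = finsum A (\<lambda>(\<alpha>, \<beta>, \<gamma>, \<delta>).
        \<theta> \<alpha> \<beta> \<gamma> \<delta> \<odot>\<^bsub>A\<^esub> nf_monomial F \<alpha> \<beta> \<gamma> \<delta>) {(\<alpha>, \<beta>, \<gamma>, \<delta>). \<theta> \<alpha> \<beta> \<gamma> \<delta> \<noteq> 0} \<and>
      finite {(\<alpha>, \<beta>, \<gamma>, \<delta>). \<theta> \<alpha> \<beta> \<gamma> \<delta> \<noteq> 0}"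
    if "\<theta> = (\<lambda>\<alpha> \<beta> \<gamma> \<delta>. Poly_Mapping.lookup \<tau> (\<alpha>, \<beta>, \<gamma>, \<delta>))" for \<tau>
  proof -
    have "{(\<alpha>, \<beta>, \<gamma>, \<delta>). \<theta> \<alpha> \<beta> \<gamma> \<delta> \<noteq> 0} = Poly_Mapping.keys \<tau>"
      by (auto simp: that in_keys_iff)
    moreover have "(\<lambda>(\<alpha>, \<beta>, \<gamma>, \<delta>). \<theta> \<alpha> \<beta> \<gamma> \<delta> \<odot>\<^bsub>A\<^esub> nf_monomial F \<alpha> \<beta> \<gamma> \<delta>) =
        (\<lambda>j. Poly_Mapping.lookup \<tau> j \<odot>\<^bsub>A\<^esub> nf j)"
      by (auto simp: that nf_def fun_eq_iff)
    ultimately show ?thesis by (simp add: lincomb_def)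
  qed
  show ?thesis
  proof
    assume exp: "is_expansion F b \<theta>"
    define \<tau> where "\<tau> = Abs_poly_mapping (\<lambda>(\<alpha>, \<beta>, \<gamma>, \<delta>). \<theta> \<alpha> \<beta> \<gamma> \<delta>)"
    have "finite {j. (\<lambda>(\<alpha>, \<beta>, \<gamma>, \<delta>). \<theta> \<alpha> \<beta> \<gamma> \<delta>) j \<noteq> 0}"
      using exp unfolding is_expansion_def
      by (elim conjE finite_subset[rotated]) auto
    then have "\<theta> = (\<lambda>\<alpha> \<beta> \<gamma> \<delta>. Poly_Mapping.lookup \<tau> (\<alpha>, \<beta>, \<gamma>, \<delta>))"
      by (simp add: \<tau>_def)
    then show "\<exists>\<tau>. \<theta> = (\<lambda>\<alpha> \<beta> \<gamma> \<delta>. Poly_Mapping.lookup \<tau> (\<alpha>, \<beta>, \<gamma>, \<delta>)) \<and> b = lincomb A nf \<tau>"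
      using lincomb[of \<tau>] exp unfolding is_expansion_def by metis
  next
    assume "\<exists>\<tau>. \<theta> = (\<lambda>\<alpha> \<beta> \<gamma> \<delta>. Poly_Mapping.lookup \<tau> (\<alpha>, \<beta>, \<gamma>, \<delta>)) \<and> b = lincomb A nf \<tau>"
    then obtain \<tau> where "\<theta> = (\<lambda>\<alpha> \<beta> \<gamma> \<delta>. Poly_Mapping.lookup \<tau> (\<alpha>, \<beta>, \<gamma>, \<delta>))" "b = lincomb A nf \<tau>"
      by blast
    then show "is_expansion F b \<theta>"
      using lincomb[of \<tau>] by (simp add: is_expansion_def)
  qed
qed

lemma ex1_expansion:
  assumes "b \<in> carrier A"
  shows "\<exists>!\<theta>. is_expansion F b \<theta>"
proof -
  have "\<exists>!\<tau>. b = lincomb A nf \<tau>"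
    using nf_basis assms unfolding is_basis_def by blast
  then obtain \<tau> where "b = lincomb A nf \<tau>" "\<And>\<tau>'. b = lincomb A nf \<tau>' \<Longrightarrow> \<tau>' = \<tau>"
    by blast
  then show ?thesis
    by (intro ex1I[of _ "\<lambda>\<alpha> \<beta> \<gamma> \<delta>. Poly_Mapping.lookup \<tau> (\<alpha>, \<beta>, \<gamma>, \<delta>)"])
      (auto simp: is_expansion_iff)
qed

text \<open>Uniqueness turns the definite description into a coordinate vector, which is where its
  linearity and finite support come from.\<close>

lemma NF_eq:
  assumes "b \<in> carrier A"
  shows "NF F b = (\<lambda>\<alpha> \<beta> \<gamma> \<delta>. Poly_Mapping.lookup (coord A nf b) (\<alpha>, \<beta>, \<gamma>, \<delta>))"
  unfolding NF_def using ex1_expansion[OF assms]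
  by (rule the1_equality) (use B.lincomb_coord[OF nf_basis assms] in \<open>auto simp: is_expansion_iff\<close>)

lemma linear_functional_NF: "linear_functional A (\<lambda>b. NF F b \<alpha> \<beta> \<gamma> \<delta>)"
  using B.linear_functional_coord[OF nf_basis, of "(\<alpha>, \<beta>, \<gamma>, \<delta>)"]
  by (simp add: linear_functional_def NF_eq)

lemma NF_nf:
  "NF F (nf (a, b, c, d)) \<alpha> \<beta> \<gamma> \<delta> =
    of_bool (\<alpha> = a) * of_bool (\<beta> = b) * of_bool (\<gamma> = c) * of_bool (\<delta> = d)"
  by (auto simp: NF_eq B.coord_basis[OF nf_basis] lookup_single when_def)

lemma finite_NF:
  assumes "b \<in> carrier A"
  shows "finite {(\<gamma>, \<delta>). NF F b \<alpha> \<beta> \<gamma> \<delta> \<noteq> 0}"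
proof -
  have "{(\<gamma>, \<delta>). NF F b \<alpha> \<beta> \<gamma> \<delta> \<noteq> 0} =
      (\<lambda>(\<gamma>, \<delta>). (\<alpha>, \<beta>, \<gamma>, \<delta>)) -` Poly_Mapping.keys (coord A nf b)"
    by (auto simp: NF_eq[OF assms] in_keys_iff)
  then show ?thesis by (simp add: finite_vimageI inj_on_def)
qed

section \<open>Right multiplication by \<open>y_l\<close> and the array \<open>Psi\<close>\<close>

lemma y2_power_y1:
  "y2 [^]\<^bsub>A\<^esub> v \<otimes>\<^bsub>A\<^esub> y1 =
    (\<Oplus>\<^bsub>A\<^esub>k\<in>{..v}. Lambda (p_of F) (s_of F) v 1 k \<odot>\<^bsub>A\<^esub> (y1 [^]\<^bsub>A\<^esub> Suc k \<otimes>\<^bsub>A\<^esub> y2 [^]\<^bsub>A\<^esub> (v - k)))"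
proof (induction v)
  case 0
  show ?case by (simp add: Lambda_def q_rising_def)
next
  case (Suc v)
  let ?\<Lambda> = "Lambda (p_of F) (s_of F)"
  let ?m = "\<lambda>k j. y1 [^]\<^bsub>A\<^esub> Suc k \<otimes>\<^bsub>A\<^esub> y2 [^]\<^bsub>A\<^esub> j"
  let ?f = "\<lambda>k. (p_of F ^ Suc k * ?\<Lambda> v 1 k) \<odot>\<^bsub>A\<^esub> ?m k (Suc v - k)"
  \<comment> \<open>\<open>?g\<close> is indexed by its target: the term produced when
    \<open>y2\<close> becomes \<open>y1\<close> raises the index by one, hence
    \<open>?g (Suc k)\<close> below. Its value at \<open>0\<close> is zero, which lets the shifted
    sum start at \<open>0\<close> again.\<close>
  let ?g = "\<lambda>k. (if k = 0 then 0 else s_of F * q_int (p_of F) k * ?\<Lambda> v 1 (k - 1)) \<odot>\<^bsub>A\<^esub> ?m k (Suc v - k)"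
  have step: "y2 \<otimes>\<^bsub>A\<^esub> (?\<Lambda> v 1 k \<odot>\<^bsub>A\<^esub> ?m k (v - k)) = ?f k \<oplus>\<^bsub>A\<^esub> ?g (Suc k)" if "k \<le> v" for k
  proof -
    have "y2 \<otimes>\<^bsub>A\<^esub> ?m k (v - k) = (y2 \<otimes>\<^bsub>A\<^esub> y1 [^]\<^bsub>A\<^esub> Suc k) \<otimes>\<^bsub>A\<^esub> y2 [^]\<^bsub>A\<^esub> (v - k)"
      by (simp add: B.m_assoc)
    also have "\<dots> = p_of F ^ Suc k \<odot>\<^bsub>A\<^esub> ?m k (Suc (v - k)) \<oplus>\<^bsub>A\<^esub>
        (s_of F * q_int (p_of F) (Suc k)) \<odot>\<^bsub>A\<^esub> ?m (Suc k) (v - k)"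
      unfolding B.commute_power[OF y_closed y_commute]
      by (simp add: B.l_distr B.smult_mult_left B.m_assoc B.nat_pow_Suc2[symmetric] del: B.nat_pow_Suc)
    finally show ?thesis
      using that by (simp add: B.smult_mult_right B.smult_add_right B.smult_smult Suc_diff_le mult.commute)
  qed
  \<comment> \<open>The new factor \<open>y2\<close> is split off on the left, where it meets a pure
    power of \<open>y1\<close> in each term of the induction hypothesis, and
    \<open>commute_power\<close> applies.\<close>
  have "y2 [^]\<^bsub>A\<^esub> Suc v \<otimes>\<^bsub>A\<^esub> y1 = y2 \<otimes>\<^bsub>A\<^esub> (y2 [^]\<^bsub>A\<^esub> v \<otimes>\<^bsub>A\<^esub> y1)"
    unfolding B.nat_pow_Suc2[OF y_closed(2)] by (simp add: B.m_assoc)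
  also have "\<dots> = (\<Oplus>\<^bsub>A\<^esub>k\<in>{..v}. y2 \<otimes>\<^bsub>A\<^esub> (?\<Lambda> v 1 k \<odot>\<^bsub>A\<^esub> ?m k (v - k)))"
    unfolding Suc by (rule B.finsum_rdistr) auto
  also have "\<dots> = (\<Oplus>\<^bsub>A\<^esub>k\<in>{..v}. ?f k \<oplus>\<^bsub>A\<^esub> ?g (Suc k))"
  proof (rule B.finsum_cong')
    show "y2 \<otimes>\<^bsub>A\<^esub> (?\<Lambda> v 1 k \<odot>\<^bsub>A\<^esub> ?m k (v - k)) = ?f k \<oplus>\<^bsub>A\<^esub> ?g (Suc k)" if "k \<in> {..v}" for k
      using that by (intro step) simp
  qed auto
  also have "\<dots> = (\<Oplus>\<^bsub>A\<^esub>k\<in>{..v}. ?f k) \<oplus>\<^bsub>A\<^esub> (\<Oplus>\<^bsub>A\<^esub>k\<in>{..v}. ?g (Suc k))"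
    by (rule B.finsum_addf) auto
  \<comment> \<open>The additional index \<open>Suc v\<close> contributes nothing, since
    \<open>Lambda\<close> vanishes there; now both sums have the range that
    \<open>Lambda_Suc\<close> compares.\<close>
  also have "(\<Oplus>\<^bsub>A\<^esub>k\<in>{..v}. ?f k) = (\<Oplus>\<^bsub>A\<^esub>k\<in>{..Suc v}. ?f k)"
    by (rule B.add.finprod_mono_neutral_cong_left) (auto simp: Lambda_def)
  also have "(\<Oplus>\<^bsub>A\<^esub>k\<in>{..v}. ?g (Suc k)) = (\<Oplus>\<^bsub>A\<^esub>k\<in>{..Suc v}. ?g k)"
    by (subst B.finsum_Suc2) auto
  also have "(\<Oplus>\<^bsub>A\<^esub>k\<in>{..Suc v}. ?f k) \<oplus>\<^bsub>A\<^esub> (\<Oplus>\<^bsub>A\<^esub>k\<in>{..Suc v}. ?g k) =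
      (\<Oplus>\<^bsub>A\<^esub>k\<in>{..Suc v}. ?f k \<oplus>\<^bsub>A\<^esub> ?g k)"
    by (rule B.finsum_addf[symmetric]) auto
  also have "\<dots> = (\<Oplus>\<^bsub>A\<^esub>k\<in>{..Suc v}. ?\<Lambda> (Suc v) 1 k \<odot>\<^bsub>A\<^esub> ?m k (Suc v - k))"
    by (rule B.finsum_cong') (auto simp: Lambda_Suc B.smult_add_left)
  finally show ?case .
qed

text \<open>The powers of \<open>x1\<close> and \<open>x2\<close> stand on the left and are not
  touched by the rearrangement. Hence \<open>Psi\<close>, which is read off with no \<open>x\<close>
  present, also describes the general case.\<close>

lemma NF_nf_mult_y:
  assumes "l \<in> {1, 2}"
  shows "NF F (nf (a, b, u, v) \<otimes>\<^bsub>A\<^esub> yB F l) \<alpha> \<beta> \<gamma> \<delta> =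
    of_bool (\<alpha> = a) * of_bool (\<beta> = b) * Psi_formula F u v l \<gamma> \<delta>"
proof (cases "l = 2")
  case True
  have "nf (a, b, u, v) \<otimes>\<^bsub>A\<^esub> y2 = nf (a, b, u, Suc v)"
    by (simp add: nf_def nf_monomial_def B.m_assoc)
  then show ?thesis by (simp add: True NF_nf Psi_formula_def)
next
  case False
  then have l: "l = 1" using assms by simp
  let ?\<Lambda> = "Lambda (p_of F) (s_of F) v 1"
  define z where "z = x1 [^]\<^bsub>A\<^esub> a \<otimes>\<^bsub>A\<^esub> x2 [^]\<^bsub>A\<^esub> b \<otimes>\<^bsub>A\<^esub> y1 [^]\<^bsub>A\<^esub> u"
  have z: "z \<in> carrier A" by (simp add: z_def)
  have "nf (a, b, u, v) \<otimes>\<^bsub>A\<^esub> y1 = z \<otimes>\<^bsub>A\<^esub> (y2 [^]\<^bsub>A\<^esub> v \<otimes>\<^bsub>A\<^esub> y1)"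
    by (simp add: nf_def nf_monomial_def B.m_assoc z_def)
  also have "\<dots> = (\<Oplus>\<^bsub>A\<^esub>k\<in>{..v}. z \<otimes>\<^bsub>A\<^esub> (?\<Lambda> k \<odot>\<^bsub>A\<^esub> (y1 [^]\<^bsub>A\<^esub> Suc k \<otimes>\<^bsub>A\<^esub> y2 [^]\<^bsub>A\<^esub> (v - k))))"
    unfolding y2_power_y1 by (rule B.finsum_rdistr) (auto simp: z)
  also have "\<dots> = (\<Oplus>\<^bsub>A\<^esub>k\<in>{..v}. ?\<Lambda> k \<odot>\<^bsub>A\<^esub> nf (a, b, u + Suc k, v - k))"
    by (rule B.finsum_cong')
      (auto simp: z B.smult_mult_right z_def nf_def nf_monomial_def B.m_assoc B.nat_pow_mult[symmetric])
  finally have "NF F (nf (a, b, u, v) \<otimes>\<^bsub>A\<^esub> y1) \<alpha> \<beta> \<gamma> \<delta> =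
      (\<Sum>k\<le>v. NF F (?\<Lambda> k \<odot>\<^bsub>A\<^esub> nf (a, b, u + Suc k, v - k)) \<alpha> \<beta> \<gamma> \<delta>)"
    by (simp add: B.linear_functional_finsum[OF linear_functional_NF])
  also have "\<dots> = (\<Sum>k\<le>v. ?\<Lambda> k * NF F (nf (a, b, u + Suc k, v - k)) \<alpha> \<beta> \<gamma> \<delta>)"
    using linear_functional_NF[of \<alpha> \<beta> \<gamma> \<delta>] by (simp add: linear_functional_def)
  finally show ?thesis
    by (simp add: l NF_nf Psi_formula_def sum_distrib_left algebra_simps plus_1_eq_Suc)
qed

lemma Psi_eq_formula:
  assumes "l \<in> {1, 2}"
  shows "Psi F u v l \<gamma> \<delta> = Psi_formula F u v l \<gamma> \<delta>"
proof -
  have "yB F l \<in> carrier A" using assms by auto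
  then have "nf (0, 0, u, v) \<otimes>\<^bsub>A\<^esub> yB F l = y1 [^]\<^bsub>A\<^esub> u \<otimes>\<^bsub>A\<^esub> y2 [^]\<^bsub>A\<^esub> v \<otimes>\<^bsub>A\<^esub> yB F l"
    by (simp add: nf_def nf_monomial_def)
  then show ?thesis
    using NF_nf_mult_y[OF assms, of 0 0 u v 0 0 \<gamma> \<delta>] by (simp add: Psi_def)
qed

lemma NF_mult_y:
  assumes b: "b \<in> carrier A" and l: "l \<in> {1, 2}"
  shows "NF F (b \<otimes>\<^bsub>A\<^esub> yB F l) \<alpha> \<beta> \<gamma> \<delta> =
    Sum_any (\<lambda>(u, v). NF F b \<alpha> \<beta> u v * Psi F u v l \<gamma> \<delta>)"
proof -
  let ?K = "Poly_Mapping.keys (coord A nf b)"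
  let ?T = "{(u, v). (\<alpha>, \<beta>, u, v) \<in> ?K}"
  have y: "yB F l \<in> carrier A" using l by auto
  have K: "NF F b \<alpha>' \<beta>' u v = Poly_Mapping.lookup (coord A nf b) (\<alpha>', \<beta>', u, v)" for \<alpha>' \<beta>' u v
    by (simp add: NF_eq[OF b])
  have "?T = (\<lambda>(u, v). (\<alpha>, \<beta>, u, v)) -` ?K" by auto
  then have T: "finite ?T" by (simp add: finite_vimageI inj_on_def)
  have "NF F (b \<otimes>\<^bsub>A\<^esub> yB F l) \<alpha> \<beta> \<gamma> \<delta> =
      NF F (lincomb A nf (coord A nf b) \<otimes>\<^bsub>A\<^esub> yB F l) \<alpha> \<beta> \<gamma> \<delta>"
    by (simp add: B.lincomb_coord[OF nf_basis b])
  also have "\<dots> = (\<Sum>j\<in>?K. Poly_Mapping.lookup (coord A nf b) j *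
      NF F (nf j \<otimes>\<^bsub>A\<^esub> yB F l) \<alpha> \<beta> \<gamma> \<delta>)"
    by (rule B.linear_functional_lincomb[OF B.linear_functional_mult_right[OF linear_functional_NF y]]) simp
  \<comment> \<open>Multiplication by \<open>y_l\<close> preserves the exponents of
    \<open>x1\<close> and \<open>x2\<close>, so only basis elements with exponents
    \<open>\<alpha>\<close>, \<open>\<beta>\<close> contribute.\<close>
  also have "\<dots> = (\<Sum>j\<in>Pair \<alpha> ` Pair \<beta> ` ?T. Poly_Mapping.lookup (coord A nf b) j *
      NF F (nf j \<otimes>\<^bsub>A\<^esub> yB F l) \<alpha> \<beta> \<gamma> \<delta>)"
    by (rule sum.mono_neutral_right) (auto simp: NF_nf_mult_y[OF l] image_iff)
  also have "\<dots> = (\<Sum>(u, v)\<in>?T. NF F b \<alpha> \<beta> u v * Psi F u v l \<gamma> \<delta>)"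
    by (simp add: image_image, subst sum.reindex)
      (auto simp: inj_on_def NF_nf_mult_y[OF l] Psi_eq_formula[OF l] K intro!: sum.cong)
  also have "\<dots> = Sum_any (\<lambda>(u, v). NF F b \<alpha> \<beta> u v * Psi F u v l \<gamma> \<delta>)"
    using T by (intro Sum_any.expand_superset[symmetric]) (auto simp: K in_keys_iff)
  finally show ?thesis .
qed

section \<open>Left multiplication by \<open>y_i\<close> and the coefficients
  \<open>W\<close>\<close>

definition xy :: "nat \<Rightarrow> nat \<times> nat \<Rightarrow> (letter fword \<Rightarrow>\<^sub>0 'k) set" where
  "xy l = (\<lambda>(\<mu>, \<nu>). x1 [^]\<^bsub>A\<^esub> \<mu> \<otimes>\<^bsub>A\<^esub> x2 [^]\<^bsub>A\<^esub> \<nu> \<otimes>\<^bsub>A\<^esub> yB F l)"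

lemma xy_eq_nf:
  "xy 1 (\<mu>, \<nu>) = nf (\<mu>, \<nu>, 1, 0)" "xy 2 (\<mu>, \<nu>) = nf (\<mu>, \<nu>, 0, 1)"
  by (simp_all add: xy_def nf_def nf_monomial_def)

lemma xy_closed [simp]: "xy 1 j \<in> carrier A" "xy 2 j \<in> carrier A"
  by (cases j, simp add: xy_eq_nf)+

text \<open>\<open>W\<close> reads off only the coefficients with \<open>y\<close>-part
  \<open>y1\<close> or \<open>y2\<close>. Since \<open>y_i r\<close> lies in
  \<open>R y1 + R y2\<close>, these are the whole normal form; expanding both coefficients from
  \<open>R\<close> in monomials gives \<open>\<rho>1\<close> and \<open>\<rho>2\<close>.\<close>

lemma y_mult_x_expansion:
  assumes i: "i \<in> {1, 2}"
  obtains \<rho>1 \<rho>2 where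
    "yB F i \<otimes>\<^bsub>A\<^esub> x1 [^]\<^bsub>A\<^esub> a \<otimes>\<^bsub>A\<^esub> x2 [^]\<^bsub>A\<^esub> b = lincomb A (xy 1) \<rho>1 \<oplus>\<^bsub>A\<^esub> lincomb A (xy 2) \<rho>2"
    "\<And>\<mu> \<nu>. W F i a b \<mu> \<nu> 1 = Poly_Mapping.lookup \<rho>1 (\<mu>, \<nu>)"
    "\<And>\<mu> \<nu>. W F i a b \<mu> \<nu> 2 = Poly_Mapping.lookup \<rho>2 (\<mu>, \<nu>)"
proof -
  let ?r = "xR_monomial F (a, b)"
  let ?z = "yB F i \<otimes>\<^bsub>A\<^esub> x1 [^]\<^bsub>A\<^esub> a \<otimes>\<^bsub>A\<^esub> x2 [^]\<^bsub>A\<^esub> b"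
  note r = R.is_basis_closed[OF xR_monomial_basis]
  have "\<exists>s1\<in>carrier (R_alg F). \<exists>s2\<in>carrier (R_alg F).
      yB F i \<otimes>\<^bsub>A\<^esub> \<iota> ?r = \<iota> s1 \<otimes>\<^bsub>A\<^esub> y1 \<oplus>\<^bsub>A\<^esub> \<iota> s2 \<otimes>\<^bsub>A\<^esub> y2"
  proof -
    have "\<exists>\<sigma>11 \<sigma>12 \<sigma>21 \<sigma>22. {\<sigma>11, \<sigma>12, \<sigma>21, \<sigma>22} \<subseteq> carrier (R_alg F) \<rightarrow> carrier (R_alg F) \<and>
        (\<forall>r\<in>carrier (R_alg F).
           y1 \<otimes>\<^bsub>A\<^esub> \<iota> r = \<iota> (\<sigma>11 r) \<otimes>\<^bsub>A\<^esub> y1 \<oplus>\<^bsub>A\<^esub> \<iota> (\<sigma>12 r) \<otimes>\<^bsub>A\<^esub> y2 \<and>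
           y2 \<otimes>\<^bsub>A\<^esub> \<iota> r = \<iota> (\<sigma>21 r) \<otimes>\<^bsub>A\<^esub> y1 \<oplus>\<^bsub>A\<^esub> \<iota> (\<sigma>22 r) \<otimes>\<^bsub>A\<^esub> y2)"
      using \<iota>(3) unfolding trimmed_double_extension_def by (elim conjE)
    then obtain \<sigma>11 \<sigma>12 \<sigma>21 \<sigma>22
      where \<sigma>: "{\<sigma>11, \<sigma>12, \<sigma>21, \<sigma>22} \<subseteq> carrier (R_alg F) \<rightarrow> carrier (R_alg F)"
        and y: "\<forall>r\<in>carrier (R_alg F).
           y1 \<otimes>\<^bsub>A\<^esub> \<iota> r = \<iota> (\<sigma>11 r) \<otimes>\<^bsub>A\<^esub> y1 \<oplus>\<^bsub>A\<^esub> \<iota> (\<sigma>12 r) \<otimes>\<^bsub>A\<^esub> y2 \<and>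
           y2 \<otimes>\<^bsub>A\<^esub> \<iota> r = \<iota> (\<sigma>21 r) \<otimes>\<^bsub>A\<^esub> y1 \<oplus>\<^bsub>A\<^esub> \<iota> (\<sigma>22 r) \<otimes>\<^bsub>A\<^esub> y2"
      by (elim exE conjE) (rule that)
    note y1 = bspec[OF y r, THEN conjunct1, of "(a, b)"] and y2 = bspec[OF y r, THEN conjunct2, of "(a, b)"]
    have closed: "\<sigma>11 ?r \<in> carrier (R_alg F)" "\<sigma>12 ?r \<in> carrier (R_alg F)"
        "\<sigma>21 ?r \<in> carrier (R_alg F)" "\<sigma>22 ?r \<in> carrier (R_alg F)"
      using \<sigma> r[of "(a, b)"] by (auto simp: Pi_iff)
    show ?thesis
    proof (cases "i = 1")
      case True
      then show ?thesis by (intro bexI[OF _ closed(1)] bexI[OF _ closed(2)]) (simp add: y1)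
    next
      case False
      then have "i = 2" using i by simp
      then show ?thesis by (intro bexI[OF _ closed(3)] bexI[OF _ closed(4)]) (simp add: y2)
    qed
  qed
  then obtain s1 s2 where s: "s1 \<in> carrier (R_alg F)" "s2 \<in> carrier (R_alg F)"
      and eq: "yB F i \<otimes>\<^bsub>A\<^esub> \<iota> ?r = \<iota> s1 \<otimes>\<^bsub>A\<^esub> y1 \<oplus>\<^bsub>A\<^esub> \<iota> s2 \<otimes>\<^bsub>A\<^esub> y2"
    by blast
  define \<rho> where "\<rho> l = coord (R_alg F) (xR_monomial F) (if l = 1 then s1 else s2)" for l :: nat
  have xy: "(\<lambda>j. \<iota> (xR_monomial F j) \<otimes>\<^bsub>A\<^esub> yB F l) = xy l" for l
    by (auto simp: xy_def \<iota>_xR_monomial fun_eq_iff)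
  have "yB F i \<in> carrier A" using i by auto
  then have "?z = yB F i \<otimes>\<^bsub>A\<^esub> \<iota> ?r"
    by (simp add: \<iota>_xR_monomial B.m_assoc)
  also have "\<dots> = lincomb A (xy 1) (\<rho> 1) \<oplus>\<^bsub>A\<^esub> lincomb A (xy 2) (\<rho> 2)"
    using hom_lincomb_mult[where e = "xR_monomial F" and \<theta> = "\<rho> 1", OF r y_closed(1)]
      hom_lincomb_mult[where e = "xR_monomial F" and \<theta> = "\<rho> 2", OF r y_closed(2)] s
    by (simp add: eq \<rho>_def R.lincomb_coord[OF xR_monomial_basis] xy)
  finally have z: "?z = lincomb A (xy 1) (\<rho> 1) \<oplus>\<^bsub>A\<^esub> lincomb A (xy 2) (\<rho> 2)" .
  have "W F i a b \<mu> \<nu> l = Poly_Mapping.lookup (\<rho> l) (\<mu>, \<nu>)" if l: "l \<in> {1, 2}" for \<mu> \<nu> l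
  proof -
    let ?f = "\<lambda>z. NF F z \<mu> \<nu> (if l = 1 then 1 else 0) (if l = 2 then 1 else 0)"
    \<comment> \<open>The exponents of \<open>y1\<close> and \<open>y2\<close> tell the two families
      apart, so the coefficient functional for \<open>l\<close> vanishes on the combination
      belonging to the other letter.\<close>
    have f: "?f (lincomb A (xy m) (\<rho> m)) = (if m = l then Poly_Mapping.lookup (\<rho> l) (\<mu>, \<nu>) else 0)"
      if m: "m \<in> {1, 2}" for m
    proof -
      have "?f (xy m j) = of_bool (j = (\<mu>, \<nu>) \<and> m = l)" for j
        using m l by (cases j) (auto simp: xy_eq_nf NF_nf)
      moreover have "xy m j \<in> carrier A" for j using m by auto
      ultimately show ?thesis
        by (auto simp: B.linear_functional_lincomb[OF linear_functional_NF] of_bool_def in_keys_iff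
            if_distrib[of "(*) _"] sum.delta cong: if_cong)
    qed
    have "W F i a b \<mu> \<nu> l = ?f (lincomb A (xy 1) (\<rho> 1)) + ?f (lincomb A (xy 2) (\<rho> 2))"
      unfolding W_def z by (rule B.linear_functional_add[OF linear_functional_NF]) simp_all
    then show ?thesis using l by (auto simp: f)
  qed
  with z show ?thesis by (intro that[of "\<rho> 1" "\<rho> 2"]) simp_all
qed

lemma finite_W:
  assumes "i \<in> {1, 2}"
  shows "finite {(\<mu>, \<nu>). \<exists>l\<in>{1, 2}. W F i a b \<mu> \<nu> l \<noteq> 0}"
proof -
  obtain \<rho>1 \<rho>2 where "\<And>\<mu> \<nu>. W F i a b \<mu> \<nu> 1 = Poly_Mapping.lookup \<rho>1 (\<mu>, \<nu>)"
      "\<And>\<mu> \<nu>. W F i a b \<mu> \<nu> 2 = Poly_Mapping.lookup \<rho>2 (\<mu>, \<nu>)"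
    by (rule y_mult_x_expansion[OF assms, of a b]) (rule that)
  then have "{(\<mu>, \<nu>). \<exists>l\<in>{1, 2}. W F i a b \<mu> \<nu> l \<noteq> 0} \<subseteq> Poly_Mapping.keys \<rho>1 \<union> Poly_Mapping.keys \<rho>2"
    by (auto simp: in_keys_iff)
  then show ?thesis by (rule finite_subset) simp
qed

text \<open>Stated for an arbitrary functional, because it is applied to a coefficient of
  \<open>NF\<close> precomposed with left multiplication by the prefix
  \<open>y1^c y2^d\<close>.\<close>

lemma linear_functional_y_mult_x:
  assumes i: "i \<in> {1, 2}" and f: "linear_functional A f"
  shows "f (yB F i \<otimes>\<^bsub>A\<^esub> x1 [^]\<^bsub>A\<^esub> a \<otimes>\<^bsub>A\<^esub> x2 [^]\<^bsub>A\<^esub> b) =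
    Sum_any (\<lambda>(\<mu>, \<nu>). \<Sum>l\<in>{1, 2}. W F i a b \<mu> \<nu> l * f (xy l (\<mu>, \<nu>)))"
proof -
  obtain \<rho>1 \<rho>2 where z: "yB F i \<otimes>\<^bsub>A\<^esub> x1 [^]\<^bsub>A\<^esub> a \<otimes>\<^bsub>A\<^esub> x2 [^]\<^bsub>A\<^esub> b =
        lincomb A (xy 1) \<rho>1 \<oplus>\<^bsub>A\<^esub> lincomb A (xy 2) \<rho>2"
      and W: "\<And>\<mu> \<nu>. W F i a b \<mu> \<nu> 1 = Poly_Mapping.lookup \<rho>1 (\<mu>, \<nu>)"
        "\<And>\<mu> \<nu>. W F i a b \<mu> \<nu> 2 = Poly_Mapping.lookup \<rho>2 (\<mu>, \<nu>)"
    by (rule y_mult_x_expansion[OF i, of a b]) (rule that)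
  \<comment> \<open>A common finite index set, so that the sums for \<open>l = 1\<close> and
    \<open>l = 2\<close> can be merged.\<close>
  let ?K = "Poly_Mapping.keys \<rho>1 \<union> Poly_Mapping.keys \<rho>2"
  have "f (yB F i \<otimes>\<^bsub>A\<^esub> x1 [^]\<^bsub>A\<^esub> a \<otimes>\<^bsub>A\<^esub> x2 [^]\<^bsub>A\<^esub> b) =
      (\<Sum>j\<in>Poly_Mapping.keys \<rho>1. Poly_Mapping.lookup \<rho>1 j * f (xy 1 j)) +
      (\<Sum>j\<in>Poly_Mapping.keys \<rho>2. Poly_Mapping.lookup \<rho>2 j * f (xy 2 j))"
    by (simp add: z B.linear_functional_add[OF f] B.linear_functional_lincomb[OF f])
  also have "(\<Sum>j\<in>Poly_Mapping.keys \<rho>1. Poly_Mapping.lookup \<rho>1 j * f (xy 1 j)) =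
      (\<Sum>j\<in>?K. Poly_Mapping.lookup \<rho>1 j * f (xy 1 j))"
    by (rule sum.mono_neutral_left) (auto simp: in_keys_iff)
  also have "(\<Sum>j\<in>Poly_Mapping.keys \<rho>2. Poly_Mapping.lookup \<rho>2 j * f (xy 2 j)) =
      (\<Sum>j\<in>?K. Poly_Mapping.lookup \<rho>2 j * f (xy 2 j))"
    by (rule sum.mono_neutral_left) (auto simp: in_keys_iff)
  also have "(\<Sum>j\<in>?K. Poly_Mapping.lookup \<rho>1 j * f (xy 1 j)) +
        (\<Sum>j\<in>?K. Poly_Mapping.lookup \<rho>2 j * f (xy 2 j)) =
      (\<Sum>(\<mu>, \<nu>)\<in>?K. \<Sum>l\<in>{1, 2}. W F i a b \<mu> \<nu> l * f (xy l (\<mu>, \<nu>)))"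
    by (subst sum.distrib[symmetric]) (auto simp: W intro!: sum.cong)
  also have "\<dots> = Sum_any (\<lambda>(\<mu>, \<nu>). \<Sum>l\<in>{1, 2}. W F i a b \<mu> \<nu> l * f (xy l (\<mu>, \<nu>)))"
    by (rule Sum_any.expand_superset[symmetric]) (auto simp: W in_keys_iff)
  finally show ?thesis .
qed

section \<open>The recursion\<close>

lemma yx_monomial_closed [simp]: "yx_monomial F c d a b \<in> carrier A"
  by (simp add: yx_monomial_def)

lemma yx_monomial_0: "yx_monomial F 0 0 a b = nf (a, b, 0, 0)"
  by (simp add: yx_monomial_def nf_def nf_monomial_def)

text \<open>By associativity, the prefix times \<open>x1^\<mu> x2^\<nu> y_l\<close> is a smaller
  \<open>yx_monomial\<close> followed by \<open>y_l\<close>; \<open>NF_mult_y\<close> evaluates the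
  latter. With \<open>i\<close> left open, this serves both choices of the split-off letter.\<close>

lemma NF_yx_monomial_step:
  assumes i: "i \<in> {1, 2}"
  shows "NF F (y1 [^]\<^bsub>A\<^esub> c \<otimes>\<^bsub>A\<^esub> y2 [^]\<^bsub>A\<^esub> d \<otimes>\<^bsub>A\<^esub> (yB F i \<otimes>\<^bsub>A\<^esub> x1 [^]\<^bsub>A\<^esub> a \<otimes>\<^bsub>A\<^esub> x2 [^]\<^bsub>A\<^esub> b)) \<alpha> \<beta> \<gamma> \<delta> =
    Sum_any (\<lambda>(\<mu>, \<nu>). \<Sum>l\<in>{1, 2}. Sum_any (\<lambda>(u, v).
      W F i a b \<mu> \<nu> l * NF F (yx_monomial F c d \<mu> \<nu>) \<alpha> \<beta> u v * Psi F u v l \<gamma> \<delta>))"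
proof -
  let ?y = "y1 [^]\<^bsub>A\<^esub> c \<otimes>\<^bsub>A\<^esub> y2 [^]\<^bsub>A\<^esub> d"
  let ?f = "\<lambda>z. NF F (?y \<otimes>\<^bsub>A\<^esub> z) \<alpha> \<beta> \<gamma> \<delta>"
  have W_f: "W F i a b \<mu> \<nu> l * ?f (xy l (\<mu>, \<nu>)) = Sum_any (\<lambda>(u, v).
      W F i a b \<mu> \<nu> l * NF F (yx_monomial F c d \<mu> \<nu>) \<alpha> \<beta> u v * Psi F u v l \<gamma> \<delta>)"
    if l: "l \<in> {1, 2}" for \<mu> \<nu> l
  proof -
    let ?m = "yx_monomial F c d \<mu> \<nu>"
    let ?g = "\<lambda>(u, v). NF F ?m \<alpha> \<beta> u v * Psi F u v l \<gamma> \<delta>"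
    have "yB F l \<in> carrier A" using l by auto
    then have "?y \<otimes>\<^bsub>A\<^esub> xy l (\<mu>, \<nu>) = ?m \<otimes>\<^bsub>A\<^esub> yB F l"
      by (simp add: xy_def yx_monomial_def B.m_assoc)
    then have "?f (xy l (\<mu>, \<nu>)) = Sum_any ?g"
      by (simp add: NF_mult_y[OF _ l])
    moreover have "finite {j. ?g j \<noteq> 0}"
      by (rule finite_subset[OF _ finite_NF[OF yx_monomial_closed]]) auto
    ultimately have "W F i a b \<mu> \<nu> l * ?f (xy l (\<mu>, \<nu>)) = Sum_any (\<lambda>j. W F i a b \<mu> \<nu> l * ?g j)"
      by (simp add: Sum_any_right_distrib)
    then show ?thesis by (simp add: case_prod_beta' mult.assoc)
  qed
  have "?f (yB F i \<otimes>\<^bsub>A\<^esub> x1 [^]\<^bsub>A\<^esub> a \<otimes>\<^bsub>A\<^esub> x2 [^]\<^bsub>A\<^esub> b) =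
      Sum_any (\<lambda>(\<mu>, \<nu>). \<Sum>l\<in>{1, 2}. W F i a b \<mu> \<nu> l * ?f (xy l (\<mu>, \<nu>)))"
    by (intro linear_functional_y_mult_x[OF i] B.linear_functional_mult_left linear_functional_NF) simp
  also have "(\<lambda>(\<mu>, \<nu>). \<Sum>l\<in>{1, 2}. W F i a b \<mu> \<nu> l * ?f (xy l (\<mu>, \<nu>))) =
      (\<lambda>(\<mu>, \<nu>). \<Sum>l\<in>{1, 2}. Sum_any (\<lambda>(u, v).
        W F i a b \<mu> \<nu> l * NF F (yx_monomial F c d \<mu> \<nu>) \<alpha> \<beta> u v * Psi F u v l \<gamma> \<delta>))"
    unfolding fun_eq_iff case_prod_beta' using W_f by (intro allI sum.cong) (auto simp: case_prod_beta')
  finally show ?thesis .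
qed

text \<open>\<open>Sum_any\<close> takes the value \<open>0\<close> on an infinite support;
  finiteness certifies that the sums of the recursion are genuine. \<open>W\<close> leaves finitely
  many \<open>(\<mu>, \<nu>)\<close>, and for each of them one normal form leaves finitely many
  \<open>(u, v)\<close>.\<close>

lemma finite_step:
  assumes i: "i \<in> {1, 2}"
  shows "finite {(\<mu>, \<nu>, l, u, v). l \<in> {1, 2} \<and>
    W F i a b \<mu> \<nu> l * NF F (yx_monomial F c d \<mu> \<nu>) \<alpha> \<beta> u v * Psi F u v l \<gamma> \<delta> \<noteq> 0}" (is "finite ?S")
proof -
  let ?M = "{(\<mu>, \<nu>). \<exists>l\<in>{1, 2}. W F i a b \<mu> \<nu> l \<noteq> 0}"
  let ?U = "\<lambda>(\<mu>, \<nu>). {(u, v). NF F (yx_monomial F c d \<mu> \<nu>) \<alpha> \<beta> u v \<noteq> 0}"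
  have "finite (SIGMA m:?M. {1, 2} \<times> ?U m)"
    using finite_W[OF i] finite_NF[OF yx_monomial_closed]
    by (intro finite_SigmaI finite_cartesian_product) (auto split: prod.split)
  moreover have "?S \<subseteq> (\<lambda>((\<mu>, \<nu>), (l, (u, v))). (\<mu>, \<nu>, l, u, v)) ` (SIGMA m:?M. {1, 2} \<times> ?U m)"
  proof
    fix s assume "s \<in> ?S"
    then obtain \<mu> \<nu> l u v where s: "s = (\<mu>, \<nu>, l, u, v)" "l \<in> {1, 2}"
        "W F i a b \<mu> \<nu> l \<noteq> 0" "NF F (yx_monomial F c d \<mu> \<nu>) \<alpha> \<beta> u v \<noteq> 0"
      by auto
    then show "s \<in> (\<lambda>((\<mu>, \<nu>), (l, (u, v))). (\<mu>, \<nu>, l, u, v)) ` (SIGMA m:?M. {1, 2} \<times> ?U m)"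
      by (intro image_eqI[of _ _ "((\<mu>, \<nu>), (l, (u, v)))"]) auto
  qed
  ultimately show ?thesis by (rule finite_surj)
qed

end

theorem proposition3p7:
  fixes F :: "'k::{alg_closed_field, field_char_0} family"
  assumes "admissible F"
  shows "\<exists>\<Theta> :: nat \<Rightarrow> nat \<Rightarrow> nat \<Rightarrow> nat \<Rightarrow> nat \<Rightarrow> nat \<Rightarrow> nat \<Rightarrow> nat \<Rightarrow> 'k.
     (\<forall>a b c d. (\<exists>!\<theta>. is_expansion F (yx_monomial F c d a b) \<theta>) \<and>
                NF F (yx_monomial F c d a b) = \<Theta> a b c d) \<and>
     (\<forall>a b \<alpha> \<beta>. \<Theta> a b 0 0 \<alpha> \<beta> 0 0 = of_bool (\<alpha> = a) * of_bool (\<beta> = b)) \<and>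
     (\<forall>a b \<alpha> \<beta> \<gamma> \<delta>. (\<gamma>, \<delta>) \<noteq> (0, 0) \<longrightarrow> \<Theta> a b 0 0 \<alpha> \<beta> \<gamma> \<delta> = 0) \<and>
     (\<forall>u v \<gamma> \<delta>. \<forall>l\<in>{1, 2}. Psi F u v l \<gamma> \<delta> = Psi_formula F u v l \<gamma> \<delta>) \<and>
     (\<forall>a b c d \<alpha> \<beta> \<gamma> \<delta>. c + d > 0 \<longrightarrow>
        (let (c', d', i0) = (if d > 0 then (c, d - 1, 2) else (c - 1, 0, 1)) in
           finite {(\<mu>, \<nu>, l, u, v). l \<in> {1, 2} \<and>
             W F i0 a b \<mu> \<nu> l * \<Theta> \<mu> \<nu> c' d' \<alpha> \<beta> u v * Psi F u v l \<gamma> \<delta> \<noteq> 0} \<and>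
           \<Theta> a b c d \<alpha> \<beta> \<gamma> \<delta> =
             Sum_any (\<lambda>(\<mu>, \<nu>). \<Sum>l\<in>{1, 2}. Sum_any (\<lambda>(u, v).
               W F i0 a b \<mu> \<nu> l * \<Theta> \<mu> \<nu> c' d' \<alpha> \<beta> u v * Psi F u v l \<gamma> \<delta>))))"
proof -
  interpret admissible_family F by standard (rule assms)
  define \<Theta> where "\<Theta> a b c d = NF F (yx_monomial F c d a b)" for a b c d
  have expansion: "(\<exists>!\<theta>. is_expansion F (yx_monomial F c d a b) \<theta>) \<and>
      NF F (yx_monomial F c d a b) = \<Theta> a b c d" for a b c d
    by (simp add: \<Theta>_def ex1_expansion)
  have initial: "\<Theta> a b 0 0 \<alpha> \<beta> \<gamma> \<delta> =
      of_bool (\<alpha> = a) * of_bool (\<beta> = b) * of_bool (\<gamma> = 0) * of_bool (\<delta> = 0)" for a b \<alpha> \<beta> \<gamma> \<delta>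
    by (simp add: \<Theta>_def yx_monomial_0 NF_nf)
  have step: "let (c', d', i0) = (if d > 0 then (c, d - 1, 2) else (c - 1, 0, 1)) in
      finite {(\<mu>, \<nu>, l, u, v). l \<in> {1, 2} \<and>
        W F i0 a b \<mu> \<nu> l * \<Theta> \<mu> \<nu> c' d' \<alpha> \<beta> u v * Psi F u v l \<gamma> \<delta> \<noteq> 0} \<and>
      \<Theta> a b c d \<alpha> \<beta> \<gamma> \<delta> =
        Sum_any (\<lambda>(\<mu>, \<nu>). \<Sum>l\<in>{1, 2}. Sum_any (\<lambda>(u, v).
          W F i0 a b \<mu> \<nu> l * \<Theta> \<mu> \<nu> c' d' \<alpha> \<beta> u v * Psi F u v l \<gamma> \<delta>))"
    if pos: "c + d > 0" for a b c d \<alpha> \<beta> \<gamma> \<delta>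
  proof -
    \<comment> \<open>Naming the triple once lets both branches share
      \<open>NF_yx_monomial_step\<close>; what remains is to regroup the product around its last
      \<open>y\<close>.\<close>
    obtain c' d' and i0 :: nat where eq: "(if d > 0 then (c, d - 1, 2) else (c - 1, 0, 1)) = (c', d', i0)"
      by (metis prod_cases3)
    then have i0: "i0 \<in> {1, 2}" by (auto split: if_splits)
    have "yx_monomial F c d a b = y1 [^]\<^bsub>A\<^esub> c' \<otimes>\<^bsub>A\<^esub> y2 [^]\<^bsub>A\<^esub> d' \<otimes>\<^bsub>A\<^esub>
        (yB F i0 \<otimes>\<^bsub>A\<^esub> x1 [^]\<^bsub>A\<^esub> a \<otimes>\<^bsub>A\<^esub> x2 [^]\<^bsub>A\<^esub> b)"
    proof (cases d)
      case 0
      \<comment> \<open>Here \<open>pos\<close> ensures that \<open>c - 1\<close> is a true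
        predecessor.\<close>
      then obtain k where "c = Suc k" using pos by (cases c) auto
      then show ?thesis using eq 0 by (auto simp: yx_monomial_def B.m_assoc)
    next
      case (Suc k)
      then show ?thesis using eq by (auto simp: yx_monomial_def B.m_assoc)
    qed
    then show ?thesis
      unfolding eq Let_def prod.case \<Theta>_def using NF_yx_monomial_step[OF i0] finite_step[OF i0] by simp
  qed
  show ?thesis
    by (rule exI[of _ \<Theta>], intro conjI allI impI ballI expansion Psi_eq_formula step)
      (auto simp: initial)
qed

end
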